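(* Let $x\in D_1$ and $\mu,\nu\in\mathbb{C}$ with $\nu+\mu\notin-\mathbb{N}$. Then $$\mathsf{Q}_\nu^\mu(x)=\sqrt{\pi}\,2^\mu\Bigg[\frac{-\Gamma\big(\frac{\nu+\mu+1}{2}\big)\sin\big(\frac{\pi}{2}(\nu+\mu)\big)}{2\,\Gamma\big(\frac{\nu-\mu+2}{2}\big)(1-x^2)^{\frac12(\nu+1)}}{}_2F_1\!\left(\frac{\nu-\mu+1}{2},\frac{\nu+\mu+1}{2};\frac12;\frac{x^2}{x^2-1}\right)$$ $$+\frac{\Gamma\big(\frac{\nu+\mu+2}{2}\big)\cos\big(\frac{\pi}{2}(\nu+\mu)\big)\,x\,(1-x^2)^{\frac12(\nu-1)}}{\Gamma\big(\frac{\nu-\mu+1}{2}\big)}{}_2F_1\!\left(\frac{\mu-\nu+1}{2},\frac{-\nu-\mu+1}{2};\frac32;\frac{x^2}{x^2-1}\right)\Bigg].$$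
   Context: $\mathbb{N}=\{1,2,3,\dots\}$, $-\mathbb{N}=\{-1,-2,\dots\}$. $D_1=\mathbb{C}\setminus((-\infty,-1]\cup[1,\infty))$, $D_2=\mathbb{C}\setminus(-\infty,1]$. Complex powers are principal values. ${}_2F_1(a,b;c;w)$ is the Gauss hypergeometric function, principal branch on $\mathbb{C}\setminus[1,\infty)$ (the analytic continuation of $\sum_{n\ge0}\frac{(a)_n(b)_n}{(c)_n}\frac{w^n}{n!}$). $1/\Gamma$ is read as the entire function (zero at the poles of $\Gamma$), and a quotient ${}_2F_1(a,b;c;w)/\Gamma(c)$ with $c\in\{0,-1,-2,\dots\}$ is read as the regularized function (continuous in $c$). Associated Legendre function of the second kind: for $z\in D_2$, $\nu+\mu\in\mathbb{C}\setminus-\mathbb{N}$, $$Q_\nu^\mu(z)=\frac{\sqrt{\pi}\,e^{i\pi\mu}\Gamma(\nu+\mu+1)(z^2-1)^{\frac12\mu}}{2^{\nu+1}\Gamma(\nu+\frac32)z^{\nu+\mu+1}}\,{}_2F_1\!\left(\tfrac{\nu+\mu+2}{2},\tfrac{\nu+\mu+1}{2};\nu+\tfrac32;\tfrac1{z^2}\right),$$ where $(z^2-1)^\alpha:=(z+1)^\alpha(z-1)^\alpha$. Ferrers function of the second kind: for $x\in(-1,1)$, $$\mathsf{Q}_\nu^\mu(x)=\tfrac12\big[e^{-\frac12 i\pi\mu}\,e^{-i\pi\mu}Q_\nu^\mu(x+i0)+e^{\frac12 i\pi\mu}\,e^{-i\pi\mu}Q_\nu^\mu(x-i0)\big],$$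 where $x\pm i0$ denotes the limit from the upper/lower half-plane, and $\mathsf{Q}_\nu^\mu$ is extended analytically to $D_1$. *)

theory Defs
  imports "HOL-Complex_Analysis.Complex_Analysis"
begin

(* Value at z of the holomorphic function on D that agrees with g on A.  For D open and
   connected and A with a limit point in D there is at most one such function; nothing is
   said about the value if there is none. *)
definition analytic_ext :: "complex set \<Rightarrow> complex set \<Rightarrow> (complex \<Rightarrow> complex) \<Rightarrow> complex \<Rightarrow> complex"
  where "analytic_ext D A g z =
    (THE y. \<exists>f. f holomorphic_on D \<and> (\<forall>t\<in>A. f t = g t) \<and> f z = y)"

definition hyp_domain :: "complex set"
  where "hyp_domain = - (complex_of_real ` {1..})"

(* Principal branch of the Gauss hypergeometric function, meant for c not in {0, -1, -2, ...}. *)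
definition hyp2F1 :: "complex \<Rightarrow> complex \<Rightarrow> complex \<Rightarrow> complex \<Rightarrow> complex"
  where "hyp2F1 a b c = analytic_ext hyp_domain (ball 0 1)
    (\<lambda>w. \<Sum>n. pochhammer a n * pochhammer b n / pochhammer c n * (w ^ n / fact n))"

(* Regularized function, the reading of the quotient 2F1(a,b;c;w) / Gamma(c) for all c:
   by 1 / Gamma(c + n) = 1 / ((c)_n Gamma(c)), see rGamma_add_of_nat below, its series is
   the Gauss series divided by Gamma(c) if c is not in {0, -1, -2, ...}, and its terms are
   entire in c. *)
definition hyp2F1_reg :: "complex \<Rightarrow> complex \<Rightarrow> complex \<Rightarrow> complex \<Rightarrow> complex"
  where "hyp2F1_reg a b c = analytic_ext hyp_domain (ball 0 1)
    (\<lambda>w. \<Sum>n. pochhammer a n * pochhammer b n * rGamma (c + of_nat n) * (w ^ n / fact n))"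

lemma rGamma_add_of_nat:
  fixes c :: complex
  assumes "c \<notin> \<int>\<^sub>\<le>\<^sub>0"
  shows "rGamma (c + of_nat n) = rGamma c / pochhammer c n"
proof -
  have "pochhammer c n \<noteq> 0"
    using assms by (auto simp: pochhammer_eq_0_iff)
  then show ?thesis
    using pochhammer_rGamma[of c n] by (simp add: field_simps)
qed

(* Associated Legendre function of the second kind, meant for z in \<complex> minus (-\<infinity>, 1] and
   \<nu> + \<mu> not in {-1, -2, ...}; (z^2 - 1) to the power \<mu>/2 is read as
   (z + 1) powr (\<mu>/2) * (z - 1) powr (\<mu>/2). *)
definition legendre_Q :: "complex \<Rightarrow> complex \<Rightarrow> complex \<Rightarrow> complex"
  where "legendre_Q \<nu> \<mu> z =
    of_real (sqrt pi) * exp (\<i> * of_real pi * \<mu>) * Gamma (\<nu> + \<mu> + 1)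
      * ((z + 1) powr (\<mu> / 2) * (z - 1) powr (\<mu> / 2))
      / (2 powr (\<nu> + 1) * z powr (\<nu> + \<mu> + 1))
      * hyp2F1_reg ((\<nu> + \<mu> + 2) / 2) ((\<nu> + \<mu> + 1) / 2) (\<nu> + 3 / 2) (1 / z\<^sup>2)"

definition legendre_Q_above :: "complex \<Rightarrow> complex \<Rightarrow> complex \<Rightarrow> complex"
  where "legendre_Q_above \<nu> \<mu> x = Lim (at x within {z. Im z > 0}) (legendre_Q \<nu> \<mu>)"

definition legendre_Q_below :: "complex \<Rightarrow> complex \<Rightarrow> complex \<Rightarrow> complex"
  where "legendre_Q_below \<nu> \<mu> x = Lim (at x within {z. Im z < 0}) (legendre_Q \<nu> \<mu>)"

definition D1 :: "complex set"
  where "D1 = - (complex_of_real ` ({..-1} \<union> {1..}))"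

(* Ferrers function of the second kind: defined on the interval (-1,1) through the boundary
   values of legendre_Q, then extended analytically to D1. *)
definition ferrers_Q :: "complex \<Rightarrow> complex \<Rightarrow> complex \<Rightarrow> complex"
  where "ferrers_Q \<nu> \<mu> = analytic_ext D1 (complex_of_real ` {-1<..<1})
    (\<lambda>x. 1 / 2 *
      (exp (- \<i> * of_real pi * \<mu> / 2) * exp (- \<i> * of_real pi * \<mu>) * legendre_Q_above \<nu> \<mu> x
       + exp (\<i> * of_real pi * \<mu> / 2) * exp (- \<i> * of_real pi * \<mu>) * legendre_Q_below \<nu> \<mu> x))"

end

theory Submission
  imports Defs "HOL-Real_Asymp.Real_Asymp"
begin

text \<open>
  Up to elementary factors, the defining expression of the Legendre function on the upper half plane is
  \<open>q(z) = z powr (-s) * F(s/2, (s+1)/2; c; 1/z^2)\<close> with \<open>s = \<nu> + \<mu> + 1\<close>, \<open>c = \<nu> + 3/2\<close>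
  and \<open>F\<close> regularized. It solves an equation of Gegenbauer type that is regular on the whole of
  \<open>D1\<close>, where an even and an odd solution are given by \<open>F(_, _; 1/2; z^2)\<close> and
  \<open>z * F(_, _; 3/2; z^2)\<close>. So \<open>q\<close> is a combination of these two, with coefficients given by the
  limits of \<open>q\<close> and \<open>q'\<close> at the origin. Along the imaginary axis Pfaff's transformation
  takes the argument of \<open>F\<close> to \<open>1\<close> from the left, and since the parameter excess is always \<open>1/2\<close>,
  Gauss's summation theorem evaluates the limit of \<open>q\<close> for all parameters; moreover \<open>q'\<close> is a multiple of
  \<open>q\<close> with \<open>s\<close> raised by one. The lower half plane follows from \<open>z \<mapsto> -z\<close>, and Pfaff's
  transformation turns the result into the stated form.
\<close>

section \<open>The regularized Gauss series\<close>

text \<open>For nonzero x in (-1,1) the point 1/x^2 lies on the cut of F, so the boundary values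
  cannot be read off the defining expression; this is the reason for passing to a differential
  equation that is regular on the interval. On the imaginary axis w = 1/z^2 is negative and w/(w -
  1) runs inside (0,1). Pfaff's transformation replaces the parameter (s + 1)/2 by c - (s + 1)/2,
  and c - s/2 - (c - (s + 1)/2) = 1/2 for all s and c, whereas the original excess c - s - 1/2 is
  arbitrary.

  A second obstacle is that \<open>hyp2F1_reg\<close> is a definite description: it is under control
  only once a holomorphic continuation of its series has been constructed for all complex
  parameters. The regularized series is kept because c = \<nu> + 3/2 may be a pole of Gamma, and
  because its contiguous relations have no exceptional values of c.

  The sine and cosine of the result come from the factors exp(i pi s) + 1 and exp(i pi s) - 1 that
  appear when the two half planes are averaged; the halved Gamma arguments come from Legendre's
  duplication formula.\<close>

definition gauss_fps :: "complex \<Rightarrow> complex \<Rightarrow> complex \<Rightarrow> complex fps" where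
  "gauss_fps a b c = Abs_fps (\<lambda>n. pochhammer a n * pochhammer b n * rGamma (c + of_nat n) / fact n)"

lemma gauss_fps_nth [simp]:
  "fps_nth (gauss_fps a b c) n = pochhammer a n * pochhammer b n * rGamma (c + of_nat n) / fact n"
  by (simp add: gauss_fps_def)

lemma gauss_fps_commute: "gauss_fps a b c = gauss_fps b a c"
  by (simp add: fps_eq_iff mult_ac)

lemma fps_deriv_gauss_fps:
  "fps_deriv (gauss_fps a b c) = fps_const (a * b) * gauss_fps (a + 1) (b + 1) (c + 1)"
proof (rule fps_ext)
  fix n
  have "(1 + of_nat n :: complex) \<noteq> 0" using of_nat_neq_0[of n, where 'a = complex] by simp
  then show "fps_nth (fps_deriv (gauss_fps a b c)) n = fps_nth (fps_const (a * b) * gauss_fps (a + 1) (b + 1) (c + 1)) n"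
    by (simp add: pochhammer_rec add_ac divide_simps)
qed

text \<open>The operator X d/dX + a multiplies the nth coefficient by n + a, and (n + a) (a)_n = a
  (a + 1)_n.\<close>

lemma gauss_fps_raise_left:
  "fps_X * fps_deriv (gauss_fps a b c) + fps_const a * gauss_fps a b c
     = fps_const a * gauss_fps (a + 1) b c"
proof (rule fps_ext)
  fix n
  have "(of_nat n + a) * pochhammer a n = a * pochhammer (a + 1) n"
    by (metis add.commute pochhammer_rec pochhammer_rec')
  then have "(of_nat n + a) * pochhammer a n * (pochhammer b n * rGamma (c + of_nat n) / fact n) =
     a * pochhammer (a + 1) n * (pochhammer b n * rGamma (c + of_nat n) / fact n)"
    by simp
  then show "fps_nth (fps_X * fps_deriv (gauss_fps a b c) + fps_const a * gauss_fps a b c) n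
     = fps_nth (fps_const a * gauss_fps (a + 1) b c) n"
    by (simp add: fps_mult_fps_X_deriv_shift ring_distribs mult_ac add_ac flip: add_divide_distrib)
qed

text \<open>The operator X d/dX + c multiplies the nth coefficient by n + c, which the functional
  equation of 1/Gamma absorbs, also at the poles of Gamma.\<close>

lemma gauss_fps_lower_denominator:
  "fps_X * fps_deriv (gauss_fps a b (c + 1)) + fps_const c * gauss_fps a b (c + 1) = gauss_fps a b c"
proof (rule fps_ext)
  fix n
  have "(c + of_nat n) * rGamma (c + 1 + of_nat n) = rGamma (c + of_nat n)"
    using rGamma_plus1[of "c + of_nat n"] by (simp add: add_ac)
  then have "(c + of_nat n) * rGamma (c + 1 + of_nat n) * (pochhammer a n * pochhammer b n / fact n)
    = rGamma (c + of_nat n) * (pochhammer a n * pochhammer b n / fact n)"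
    by simp
  then show "fps_nth (fps_X * fps_deriv (gauss_fps a b (c + 1)) + fps_const c * gauss_fps a b (c + 1)) n
    = fps_nth (gauss_fps a b c) n"
    by (simp add: fps_mult_fps_X_deriv_shift ring_distribs mult_ac add_ac flip: add_divide_distrib)
qed

text \<open>The series with parameters a + 1, b + 1, c, times a b, is reached from G in two ways: by
  raising a and then b, and by differentiating and then lowering c + 1 to c. Equating the two is the
  hypergeometric equation.\<close>

lemma gauss_fps_ODE:
  fixes a b c defines "G \<equiv> gauss_fps a b c"
  shows "fps_X * (1 - fps_X) * fps_deriv (fps_deriv G)
    + (fps_const c - fps_const (a + b + 1) * fps_X) * fps_deriv G - fps_const (a * b) * G = 0"
proof -
  define A B where "A = gauss_fps (a + 1) b c" and "B = gauss_fps (a + 1) (b + 1) (c + 1)"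
  have G': "fps_deriv G = fps_const (a * b) * B"
    unfolding G_def B_def by (rule fps_deriv_gauss_fps)
  have A: "fps_X * fps_deriv G + fps_const a * G = fps_const a * A"
    unfolding G_def A_def by (rule gauss_fps_raise_left)
  have A': "fps_X * fps_deriv A + fps_const b * A = fps_const b * gauss_fps (a + 1) (b + 1) c"
    unfolding A_def by (subst (1 2 3) gauss_fps_commute) (rule gauss_fps_raise_left)
  have B': "fps_X * fps_deriv B + fps_const c * B = gauss_fps (a + 1) (b + 1) c"
    unfolding B_def by (rule gauss_fps_lower_denominator)
  have "fps_X * fps_deriv (fps_deriv G) + fps_const c * fps_deriv G
    = fps_const a * (fps_const b * (fps_X * fps_deriv B + fps_const c * B))"
    by (simp add: G' algebra_simps flip: fps_const_mult)
  also have "\<dots> = fps_X * fps_deriv (fps_const a * A) + fps_const b * (fps_const a * A)"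
    unfolding B' A'[symmetric] by (simp add: algebra_simps)
  finally have "fps_X * fps_deriv (fps_deriv G) + fps_const c * fps_deriv G =
      fps_X * fps_deriv (fps_X * fps_deriv G + fps_const a * G)
      + fps_const b * (fps_X * fps_deriv G + fps_const a * G)"
    unfolding A .
  then show ?thesis
    by (simp add: algebra_simps flip: fps_const_mult fps_const_add)
qed

section \<open>Growth of the coefficients\<close>

lemma pochhammer_over_fact_bigo:
  "(\<lambda>n. pochhammer a n / fact n :: complex) \<in> O(\<lambda>n. of_real (real n powr (Re a - 1)))"
proof -
  have "(\<lambda>n. rGamma_series a n) \<in> O(\<lambda>_. 1)"
    by (rule bigoI_tendsto[where c = "rGamma a"]) (simp_all add: rGamma_series_LIMSEQ)
  \<comment> \<open>\<open>rGamma_series a n\<close> contains the Pochhammer symbol of order n + 1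
    over n! n^a; the new factor restores n^a and removes the last factor a + n.\<close>
  then have "(\<lambda>n. rGamma_series a n * (exp (a * of_real (ln (real n))) / (a + of_nat n)))
     \<in> O(\<lambda>n. 1 * of_real (real n powr (Re a - 1)))"
  proof (rule landau_o.big_mult)
    show "(\<lambda>n. exp (a * of_real (ln (real n))) / (a + of_nat n)) \<in> O(\<lambda>n. complex_of_real (real n powr (Re a - 1)))"
    proof (rule bigoI[where c = 2])
      show "\<forall>\<^sub>F n in sequentially. norm (exp (a * of_real (ln (real n))) / (a + of_nat n))
         \<le> 2 * norm (complex_of_real (real n powr (Re a - 1)))"
        using eventually_ge_at_top[of "nat \<lceil>2 * norm a\<rceil> + 1"]
      proof eventually_elim
        case (elim n)
        have n: "real n \<ge> 2 * norm a" "n > 0" using elim by linarith+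
        have "norm (of_nat n :: complex) \<le> norm (a + of_nat n) + norm a"
          using norm_triangle_ineq4[of "a + of_nat n" a] by simp
        then have "norm (a + of_nat n) \<ge> real n / 2" using n by simp
        then have "real n powr Re a / norm (a + of_nat n) \<le> real n powr Re a / (real n / 2)"
          using n by (intro divide_left_mono mult_pos_pos) auto
        then show ?case using n
          by (simp add: norm_divide powr_diff) (simp add: powr_def mult_ac)
      qed
    qed
  qed
  moreover have "eventually (\<lambda>n. rGamma_series a n * (exp (a * of_real (ln (real n))) / (a + of_nat n))
       = pochhammer a n / fact n) sequentially"
    using eventually_gt_at_top[of "nat \<lceil>norm a\<rceil>"]
  proof eventually_elim
    case (elim n)
    then have "norm a < norm (of_nat n :: complex)" by simp linarith
    then have "a + of_nat n \<noteq> 0"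
      by (metis add_eq_0_iff norm_minus_cancel order_less_irrefl)
    then show ?case by (simp add: rGamma_series_def pochhammer_rec' mult_ac)
  qed
  ultimately show ?thesis
    by (subst (asm) landau_o.big.in_cong) auto
qed

text \<open>For Re c > 0 one has 1/Gamma(c + n) = 1/(Gamma(c) (c)_n), and the bound follows from
  convergence of \<open>Gamma_series'\<close>. For other c this quotient may be 0/0, so c is first
  moved to the right by integers; each step back costs a factor c + n of order n.\<close>

lemma rGamma_times_fact_bigo:
  "(\<lambda>n. rGamma (c + of_nat n) * fact n :: complex) \<in> O(\<lambda>n. of_real (real n powr (1 - Re c)))"
proof -
  have main: "(\<lambda>n. rGamma (c + of_nat n) * fact n :: complex) \<in> O(\<lambda>n. of_real (real n powr (1 - Re c)))"
    if "Re c + real m > 0" for m c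
    using that
  proof (induction m arbitrary: c)
    case 0
    then have c: "c \<notin> \<int>\<^sub>\<le>\<^sub>0" by (auto elim!: nonpos_Ints_cases)
    have "(\<lambda>n. rGamma c * Gamma_series' c n) \<in> O(\<lambda>_. 1)"
      by (rule bigoI_tendsto[where c = "rGamma c * Gamma c"]) (auto intro!: tendsto_intros Gamma_series'_LIMSEQ)
    then have "(\<lambda>n. (rGamma c * Gamma_series' c n) * (of_nat n * exp (- (c * of_real (ln (real n))))))
       \<in> O(\<lambda>n. 1 * of_real (real n powr (1 - Re c)))"
    proof (rule landau_o.big_mult)
      show "(\<lambda>n. of_nat n * exp (- (c * complex_of_real (ln (real n))))) \<in> O(\<lambda>n. complex_of_real (real n powr (1 - Re c)))"
        by (rule bigoI[where c = 1], rule eventually_mono[OF eventually_gt_at_top[of 0]])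
           (simp add: norm_mult norm_divide powr_def exp_diff left_diff_distrib exp_minus divide_simps)
    qed
    moreover have "eventually (\<lambda>n. rGamma c * Gamma_series' c n * (of_nat n * exp (- (c * of_real (ln (real n)))))
        = rGamma (c + of_nat n) * fact n) sequentially"
      using eventually_gt_at_top[of 0]
    proof eventually_elim
      case (elim n)
      have "rGamma (c + of_nat n) = rGamma c / pochhammer c n"
        by (rule rGamma_add_of_nat[OF c])
      then show ?case using elim
        by (simp add: Gamma_series'_def exp_minus field_simps fact_num_eq_if)
    qed
    ultimately show ?case by (subst (asm) landau_o.big.in_cong) auto
  next
    case (Suc m)
    have "(\<lambda>n. rGamma (c + 1 + of_nat n) * fact n :: complex) \<in> O(\<lambda>n. of_real (real n powr (1 - Re (c + 1))))"
      using Suc.prems by (intro Suc.IH) simp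
    then have "(\<lambda>n. (c + of_nat n) * (rGamma (c + 1 + of_nat n) * fact n)) 
      \<in> O(\<lambda>n. of_nat n * of_real (real n powr (1 - Re (c + 1))))"
    proof (rule landau_o.big_mult[rotated])
      show "(\<lambda>n. c + of_nat n) \<in> O(\<lambda>n. of_nat n :: complex)"
      proof (rule bigoI[where c = "norm c + 1"], rule eventually_mono[OF eventually_gt_at_top[of 0]])
        fix n :: nat assume "0 < n"
        then have "norm c * 1 \<le> norm c * real n" by (intro mult_left_mono) auto
        then show "norm (c + of_nat n) \<le> (norm c + 1) * norm (of_nat n :: complex)"
          using norm_triangle_ineq[of c "of_nat n"] by (simp add: algebra_simps)
      qed
    qed
    also have "(\<lambda>n. of_nat n * complex_of_real (real n powr (1 - Re (c + 1)))) \<in> O(\<lambda>n. of_real (real n powr (1 - Re c)))"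
      by (rule bigoI[where c = 1], rule eventually_mono[OF eventually_gt_at_top[of 0]])
         (simp add: norm_mult norm_divide powr_diff powr_minus divide_inverse)
    finally have "(\<lambda>n. (c + of_nat n) * (rGamma (c + 1 + of_nat n) * fact n)) \<in> O(\<lambda>n. complex_of_real (real n powr (1 - Re c)))" .
    moreover have "(c + of_nat n) * (rGamma (c + 1 + of_nat n) * fact n) = rGamma (c + of_nat n) * fact n" for n
      using rGamma_plus1[of "c + of_nat n"] by (simp add: add_ac)
    ultimately show ?case by simp
  qed
  obtain m where "real m > - Re c" using reals_Archimedean2 by blast
  then show ?thesis by (intro main[of c m]) simp
qed

lemma gauss_fps_nth_bigo:
  "(\<lambda>n. fps_nth (gauss_fps a b c) n) \<in> O(\<lambda>n. of_real (real n powr (Re (a + b - c) - 1)))"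
proof -
  have "(\<lambda>n. pochhammer a n / fact n * (pochhammer b n / fact n) * (rGamma (c + of_nat n) * fact n))
    \<in> O(\<lambda>n. complex_of_real (real n powr (Re a - 1)) * of_real (real n powr (Re b - 1)) * of_real (real n powr (1 - Re c)))"
    by (intro landau_o.big_mult pochhammer_over_fact_bigo rGamma_times_fact_bigo)
  also have "(\<lambda>n. complex_of_real (real n powr (Re a - 1)) * of_real (real n powr (Re b - 1)) * of_real (real n powr (1 - Re c)))
     = (\<lambda>n. of_real (real n powr (Re (a + b - c) - 1)))"
    by (simp add: fun_eq_iff algebra_simps flip: of_real_mult powr_add)
  finally show ?thesis by (simp add: mult_ac)
qed

lemma summable_norm_comparison_bigo:
  fixes f :: "nat \<Rightarrow> complex"
  assumes "f \<in> O(\<lambda>n. of_real (g n))" "summable (\<lambda>n. \<bar>g n\<bar>)"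
  shows "summable (\<lambda>n. norm (f n))"
proof (rule summable_comparison_test_bigo)
  from assms(1) have "(\<lambda>n. norm (f n)) \<in> O(\<lambda>n. norm (complex_of_real (g n)))"
    by (subst landau_o.big.norm_iff)
  then show "(\<lambda>n. norm (f n)) \<in> O(g)" by simp
qed (use assms(2) in simp)

section \<open>Continuation to the slit plane\<close>

lemma hyp_domain_iff: "w \<in> hyp_domain \<longleftrightarrow> Im w \<noteq> 0 \<or> Re w < 1"
  by (auto simp: hyp_domain_def image_iff complex_eq_iff not_le)

lemma open_hyp_domain: "open hyp_domain"
proof -
  have eq: "hyp_domain = {w. Im w \<noteq> 0} \<union> {w. Re w < 1}"
    by (auto simp: hyp_domain_iff)
  show ?thesis
    unfolding eq by (intro open_Un open_Collect_neq open_Collect_less continuous_intros)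
qed

text \<open>The segment from 1 to 1 - w avoids the cut of the principal power. This makes the kernel
  of Euler's integral differentiable in w and the slit plane starlike about 0.\<close>

lemma one_minus_mult_hyp_domain:
  assumes "w \<in> hyp_domain" "t \<in> {0..1}"
  shows "1 - w * of_real t \<notin> \<real>\<^sub>\<le>\<^sub>0"
proof
  assume "1 - w * of_real t \<in> \<real>\<^sub>\<le>\<^sub>0"
  then have *: "Re w * t \<ge> 1" "Im w * t = 0" by (auto simp: complex_nonpos_Reals_iff)
  then have "t > 0" "Im w = 0" using assms(2) by (auto simp: less_le)
  then have "Re w < 1" using assms(1) by (simp add: hyp_domain_iff)
  moreover have "Re w * t \<le> max 0 (Re w)"
    using assms(2) \<open>t > 0\<close> by (cases "Re w > 0") (auto simp: mult_le_0_iff mult_left_le)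
  ultimately show False using * by simp
qed

lemma mem_hyp_domain_iff: "w \<in> hyp_domain \<longleftrightarrow> 1 - w \<notin> \<real>\<^sub>\<le>\<^sub>0"
  by (auto simp: hyp_domain_iff complex_nonpos_Reals_iff)

lemma starlike_hyp_domain: "starlike hyp_domain"
  unfolding starlike_def
proof (intro bexI[of _ 0] ballI subsetI)
  fix w z assume "w \<in> hyp_domain" and z: "z \<in> closed_segment 0 w"
  from z obtain t where "t \<in> {0..1}" "z = w * of_real t"
    by (auto simp: closed_segment_def scaleR_conv_of_real mult_ac)
  then show "z \<in> hyp_domain"
    using one_minus_mult_hyp_domain[OF \<open>w \<in> hyp_domain\<close>] by (simp add: mem_hyp_domain_iff)
qed (simp add: hyp_domain_iff)

lemma connected_hyp_domain: "connected hyp_domain"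
  by (rule starlike_imp_connected) (rule starlike_hyp_domain)

lemma zero_in_hyp_domain [simp]: "0 \<in> hyp_domain"
  by (simp add: hyp_domain_iff)

lemma ball_subset_hyp_domain: "ball 0 1 \<subseteq> hyp_domain"
proof
  fix w :: complex assume "w \<in> ball 0 1"
  then have "Re w < 1" using complex_Re_le_cmod[of w] by simp
  then show "w \<in> hyp_domain" by (simp add: hyp_domain_iff)
qed

text \<open>Vanishing moments make h orthogonal to every polynomial p. With p uniformly within e of
  h, the integral of h^2 equals that of h (h - p) and is at most e times the integral of |h|; so it
  is zero.\<close>

lemma continuous_real_moments_zero:
  fixes h :: "real \<Rightarrow> real"
  assumes h: "continuous_on {0..1} h" and M: "\<And>n. integral {0..1} (\<lambda>t. h t * t ^ n) = 0"
    and t: "t \<in> {0..1}"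
  shows "h t = 0"
proof -
  have [continuous_intros]: "continuous_on {0..1} h" by (rule h)
  define B where "B = integral {0..1} (\<lambda>t. \<bar>h t\<bar>)"
  have le: "integral {0..1} (\<lambda>t. (h t)\<^sup>2) \<le> e * B" if e: "e > 0" for e
  proof -
    obtain p where p: "real_polynomial_function p" "\<And>x. x \<in> {0..1} \<Longrightarrow> \<bar>h x - p x\<bar> < e"
      using Stone_Weierstrass_real_polynomial_function[OF _ h e] by auto
    from p(1) obtain a n where p': "p = (\<lambda>x. \<Sum>i\<le>n. a i * x ^ i)"
      by (auto simp: real_polynomial_function_iff_sum)
    have hp: "((\<lambda>t. h t * p t) has_integral 0) {0..1}"
    proof -
      have "((\<lambda>t. h t * t ^ i) has_integral 0) {0..1}" for i
        by (subst M[of i, symmetric])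
           (intro integrable_integral integrable_continuous_interval continuous_intros)
      then have "((\<lambda>t. \<Sum>i\<le>n. a i * (h t * t ^ i)) has_integral (\<Sum>i\<le>n. a i * 0)) {0..1}"
        by (intro has_integral_sum has_integral_mult_right) auto
      then show ?thesis by (simp add: p' sum_distrib_left mult_ac)
    qed
    have "((\<lambda>t. (h t)\<^sup>2) has_integral integral {0..1} (\<lambda>t. (h t)\<^sup>2)) {0..1}"
      by (intro integrable_integral integrable_continuous_interval continuous_intros)
    from has_integral_diff[OF this hp] have "((\<lambda>t. (h t)\<^sup>2 - h t * p t) has_integral integral {0..1} (\<lambda>t. (h t)\<^sup>2)) {0..1}"
      by simp
    moreover have "((\<lambda>t. e * \<bar>h t\<bar>) has_integral e * B) {0..1}"
      unfolding B_def
      by (intro has_integral_mult_right integrable_integral integrable_continuous_interval continuous_intros)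
    ultimately show ?thesis
    proof (rule has_integral_le)
      fix t :: real assume "t \<in> {0..1}"
      then have "\<bar>h t\<bar> * \<bar>h t - p t\<bar> \<le> \<bar>h t\<bar> * e" using p(2)[of t] by (intro mult_left_mono) auto
      moreover have "(h t)\<^sup>2 - h t * p t \<le> \<bar>h t * (h t - p t)\<bar>"
        by (simp add: power2_eq_square algebra_simps)
      ultimately show "(h t)\<^sup>2 - h t * p t \<le> e * \<bar>h t\<bar>" by (simp add: abs_mult mult_ac)
    qed
  qed
  have "integral {0..1} (\<lambda>t. (h t)\<^sup>2) \<le> 0"
  proof (rule field_le_epsilon)
    fix e :: real assume "e > 0"
    have B: "B \<ge> 0" unfolding B_def by (intro integral_nonneg integrable_continuous_interval continuous_intros) auto
    \<comment> \<open>The denominator is B + 1 because B may be zero.\<close>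
    have "integral {0..1} (\<lambda>t. (h t)\<^sup>2) \<le> e / (B + 1) * B" by (rule le) (use \<open>e > 0\<close> B in auto)
    also have "\<dots> \<le> e" using \<open>e > 0\<close> B by (simp add: field_simps)
    finally show "integral {0..1} (\<lambda>t. (h t)\<^sup>2) \<le> 0 + e" by simp
  qed
  moreover have "integral {0..1} (\<lambda>t. (h t)\<^sup>2) \<ge> 0"
    by (intro integral_nonneg integrable_continuous_interval continuous_intros) auto
  ultimately have "((\<lambda>t. (h t)\<^sup>2) has_integral 0) {0..1}"
    by (metis antisym integrable_integral integrable_continuous_interval continuous_on_power h)
  then have "(h t)\<^sup>2 = 0" using t
    by (intro has_integral_0_cbox_imp_0[of 0 1 "\<lambda>t. (h t)\<^sup>2"]) (auto intro!: continuous_intros)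
  then show ?thesis by simp
qed

section \<open>Euler's integral and the moments of the Beta weight\<close>

definition euler_integral :: "(real \<Rightarrow> complex) \<Rightarrow> complex \<Rightarrow> nat \<Rightarrow> complex \<Rightarrow> complex" where
  "euler_integral h a n w = integral {0..1} (\<lambda>t. h t * of_real t ^ n * (1 - w * of_real t) powr (- a))"

lemma has_field_derivative_euler_integral:
  assumes h: "continuous_on {0..1} h" and w: "w \<in> hyp_domain"
  shows "(euler_integral h a n has_field_derivative a * euler_integral h (a + 1) (Suc n) w) (at w)"
proof -
  obtain e where e: "e > 0" "ball w e \<subseteq> hyp_domain"
    using open_hyp_domain w open_contains_ball by blast
  have cont: "continuous_on (ball w e \<times> {0..1}) (\<lambda>(w, t). h t * of_real t ^ m * (1 - w * of_real t) powr b)" for b m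
  proof -
    let ?S = "ball w e \<times> {0..1::real}"
    have ok: "1 - fst p * of_real (snd p) \<notin> \<real>\<^sub>\<le>\<^sub>0" if "p \<in> ?S" for p
      using one_minus_mult_hyp_domain[of "fst p" "snd p"] e(2) that by auto
    have c1: "continuous_on ?S (\<lambda>p. (1 - fst p * of_real (snd p)) powr b)"
    proof (rule continuous_on_powr_complex)
      show "?S \<subseteq> {p. 0 \<le> Re (1 - fst p * of_real (snd p)) \<or> Im (1 - fst p * of_real (snd p)) \<noteq> 0}"
        using ok unfolding complex_nonpos_Reals_iff by force
      show "0 < Re b" if "p \<in> ?S" "1 - fst p * of_real (snd p) = 0" for p
        using ok[OF that(1)] that(2) by simp
    qed (intro continuous_intros)+
    have c2: "continuous_on ?S (\<lambda>p. h (snd p))"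
      by (rule continuous_on_compose2[OF h]) (auto intro!: continuous_intros)
    show ?thesis
      unfolding case_prod_unfold
      by (intro continuous_on_mult c1 c2 continuous_on_power continuous_on_of_real continuous_on_snd continuous_on_id)
  qed
  have cont1: "continuous_on {0..1} (\<lambda>t. h t * of_real t ^ m * (1 - z * of_real t) powr b)"
    if "z \<in> ball w e" for z b m
  proof -
    have "continuous_on {0..1} (Pair z)" by (intro continuous_intros)
    moreover have "Pair z ` {0..1} \<subseteq> ball w e \<times> {0..1}" using that by blast
    ultimately show ?thesis using continuous_on_compose2[OF cont] by fastforce
  qed
  have "((\<lambda>z. integral (cbox 0 1) (\<lambda>t. h t * of_real t ^ n * (1 - z * of_real t) powr (- a)))
    has_field_derivative integral (cbox 0 1) (\<lambda>t. a * (h t * of_real t ^ Suc n * (1 - w * of_real t) powr (- (a + 1)))))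
      (at w within ball w e)"
  proof (rule leibniz_rule_field_derivative)
    fix z and t :: real assume z: "z \<in> ball w e" and t: "t \<in> cbox 0 1"
    then have "1 - z * of_real t \<notin> \<real>\<^sub>\<le>\<^sub>0"
      using one_minus_mult_hyp_domain e(2) by auto
    then show "((\<lambda>z. h t * of_real t ^ n * (1 - z * of_real t) powr - a) has_field_derivative
        a * (h t * of_real t ^ Suc n * (1 - z * of_real t) powr - (a + 1))) (at z within ball w e)"
      by (auto intro!: derivative_eq_intros simp: mult_ac)
  next
    show "(\<lambda>t. h t * of_real t ^ n * (1 - z * of_real t) powr - a) integrable_on cbox 0 1" if "z \<in> ball w e" for z
      using cont1[OF that] by (auto intro!: integrable_continuous_interval)
  next
    have "continuous_on (ball w e \<times> {0..1}) (\<lambda>x. a * (case x of (z, t) \<Rightarrow> h t * of_real t ^ Suc n * (1 - z * of_real t) powr - (a + 1)))"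
      by (intro continuous_intros cont)
    then show "continuous_on (ball w e \<times> cbox 0 1) (\<lambda>(z, t). a * (h t * of_real t ^ Suc n * (1 - z * of_real t) powr - (a + 1)))"
      by (simp add: case_prod_unfold)
  qed (use e in auto)
  then show ?thesis
    using e(1) by (simp add: euler_integral_def[abs_def] at_within_open[of w "ball w e"])
qed

lemma holomorphic_on_euler_integral:
  assumes "continuous_on {0..1} h"
  shows "euler_integral h a n holomorphic_on hyp_domain"
  using has_field_derivative_euler_integral[OF assms] open_hyp_domain
  by (auto simp: holomorphic_on_open)

text \<open>Each differentiation brings down one factor t and raises the exponent parameter. At w =
  0 the kernel is 1, so the Taylor coefficients become moments of h.\<close>

lemma higher_deriv_euler_integral:
  assumes "continuous_on {0..1} h" "w \<in> hyp_domain"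
  shows "(deriv ^^ n) (euler_integral h a 0) w = pochhammer a n * euler_integral h (a + of_nat n) n w"
  using assms(2)
proof (induction n arbitrary: w)
  case (Suc n)
  have "(deriv ^^ Suc n) (euler_integral h a 0) w = deriv ((deriv ^^ n) (euler_integral h a 0)) w"
    by simp
  also have "\<dots> = deriv (\<lambda>w. pochhammer a n * euler_integral h (a + of_nat n) n w) w"
    using Suc eventually_nhds_in_open[OF open_hyp_domain Suc.prems]
    by (intro deriv_cong_ev) (auto elim!: eventually_mono)
  also have "\<dots> = pochhammer a n * ((a + of_nat n) * euler_integral h (a + of_nat n + 1) (Suc n) w)"
    by (intro DERIV_imp_deriv DERIV_cmult has_field_derivative_euler_integral assms Suc.prems)
  finally show ?case by (simp add: pochhammer_rec' add_ac mult_ac)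
qed simp

definition beta_weight :: "complex \<Rightarrow> complex \<Rightarrow> real \<Rightarrow> complex" where
  "beta_weight b d t = of_real t powr (b - 1) * (1 - of_real t) powr (d - 1)"

text \<open>Real parts above 1 make both exponents have positive real part, so the weight is
  continuous up to the endpoints and improper integrals are avoided.\<close>

lemma continuous_on_beta_weight:
  assumes "Re b > 1" "Re d > 1"
  shows "continuous_on {0..1} (beta_weight b d)"
  unfolding beta_weight_def[abs_def] using assms by (intro continuous_intros) auto

text \<open>The function t^(b+n) (1-t)^d vanishes at both endpoints, and its derivative is a
  combination of the integrands of two consecutive moments.\<close>

lemma beta_weight_moment_rec:
  assumes "Re b > 1" "Re d > 1"
  defines "M \<equiv> \<lambda>n. integral {0..1} (\<lambda>t. beta_weight b d t * of_real t ^ n)"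
  shows "(b + d + of_nat n) * M (Suc n) = (b + of_nat n) * M n"
proof -
  have M: "((\<lambda>t. beta_weight b d t * of_real t ^ m) has_integral M m) {0..1}" for m
    unfolding M_def
    by (intro integrable_integral integrable_continuous_interval continuous_intros continuous_on_beta_weight assms)
  define F where "F = (\<lambda>z::complex. z powr b * z ^ n * (1 - z) powr d)"
  have "((\<lambda>t. (b + of_nat n) * (beta_weight b d t * of_real t ^ n)
          - (b + d + of_nat n) * (beta_weight b d t * of_real t ^ Suc n)) has_integral
      F (of_real 1) - F (of_real 0)) {0..1}"
  proof (rule fundamental_theorem_of_calculus_interior)
    show "continuous_on {0..1} (\<lambda>t. F (of_real t))"
      unfolding F_def using assms by (intro continuous_intros) auto
    fix t :: real assume t: "t \<in> {0<..<1}"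
    define z where "z = complex_of_real t"
    have z: "z \<notin> \<real>\<^sub>\<le>\<^sub>0" "1 - z \<notin> \<real>\<^sub>\<le>\<^sub>0" "z \<noteq> 0" "1 - z \<noteq> 0"
      using t by (auto simp: z_def complex_nonpos_Reals_iff complex_eq_iff)
    \<comment> \<open>For n = 0 the truncated exponent is harmless, since the factor n
      vanishes.\<close>
    have n: "of_nat n * z ^ (n - Suc 0) * z = of_nat n * z ^ n" by (cases n) auto
    have "(F has_field_derivative z powr (b - 1) * (1 - z) powr (d - 1) *
        (b * z ^ n * (1 - z) + (of_nat n * z ^ (n - Suc 0)) * z * (1 - z) - d * z ^ n * z)) (at z)"
      unfolding F_def using z
      by (auto intro!: derivative_eq_intros simp: powr_diff field_simps)
    also have "z powr (b - 1) * (1 - z) powr (d - 1) *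
        (b * z ^ n * (1 - z) + (of_nat n * z ^ (n - Suc 0)) * z * (1 - z) - d * z ^ n * z) =
        (b + of_nat n) * (beta_weight b d t * of_real t ^ n)
          - (b + d + of_nat n) * (beta_weight b d t * of_real t ^ Suc n)"
      unfolding n by (simp add: beta_weight_def z_def algebra_simps)
    finally show "((\<lambda>t. F (of_real t)) has_vector_derivative
       (b + of_nat n) * (beta_weight b d t * of_real t ^ n)
          - (b + d + of_nat n) * (beta_weight b d t * of_real t ^ Suc n)) (at t)"
      unfolding z_def by (rule has_vector_derivative_real_field)
  qed simp
  moreover have "F (of_real 1) - F (of_real 0) = 0"
    by (simp add: F_def)
  moreover have "((\<lambda>t. (b + of_nat n) * (beta_weight b d t * of_real t ^ n)
          - (b + d + of_nat n) * (beta_weight b d t * of_real t ^ Suc n)) has_integral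
        (b + of_nat n) * M n - (b + d + of_nat n) * M (Suc n)) {0..1}"
    by (intro has_integral_diff has_integral_mult_right M)
  ultimately show ?thesis
    by (metis (no_types, lifting) has_integral_unique right_minus_eq)
qed

lemma beta_weight_moment:
  assumes "Re b > 1" "Re d > 1"
  defines "M \<equiv> \<lambda>n. integral {0..1} (\<lambda>t. beta_weight b d t * of_real t ^ n)"
  shows "pochhammer (b + d) n * M n = pochhammer b n * M 0"
proof (induction n)
  case (Suc n)
  have "pochhammer (b + d) (Suc n) * M (Suc n) = pochhammer (b + d) n * ((b + d + of_nat n) * M (Suc n))"
    by (simp add: pochhammer_rec' mult_ac)
  also have "(b + d + of_nat n) * M (Suc n) = (b + of_nat n) * M n"
    unfolding M_def by (rule beta_weight_moment_rec[OF assms(1,2)])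
  also have "pochhammer (b + d) n * ((b + of_nat n) * M n) = (b + of_nat n) * (pochhammer (b + d) n * M n)"
    by (simp only: mult_ac)
  finally show ?case unfolding Suc by (simp only: pochhammer_rec' mult_ac)
qed simp

text \<open>If the integral vanished, then so would all moments, and the weight itself by Weierstrass approximation.\<close>

lemma beta_weight_integral_nonzero:
  assumes "Re b > 1" "Re d > 1"
  shows "integral {0..1} (beta_weight b d) \<noteq> 0"
proof
  assume *: "integral {0..1} (beta_weight b d) = 0"
  have pos: "pochhammer (b + d) n \<noteq> 0" for n
    using assms by (auto simp: pochhammer_eq_0_iff dest: arg_cong[where f = Re])
  have int: "(\<lambda>t. beta_weight b d t * of_real t ^ n) integrable_on {0..1}" for n
    by (intro integrable_continuous_interval continuous_intros continuous_on_beta_weight assms)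
  have M: "integral {0..1} (\<lambda>t. beta_weight b d t * of_real t ^ n) = 0" for n
    using beta_weight_moment[OF assms, of n] * pos by simp
  have int0: "((\<lambda>t. beta_weight b d t * of_real t ^ n) has_integral 0) {0..1}" for n
    using int[of n] M[of n] by (metis integrable_integral)
  have "Re (beta_weight b d (1/2)) = 0"
  proof (rule continuous_real_moments_zero[where h = "\<lambda>t. Re (beta_weight b d t)"])
    show "continuous_on {0..1} (\<lambda>t. Re (beta_weight b d t))"
      by (intro continuous_intros continuous_on_beta_weight assms)
    show "integral {0..1} (\<lambda>t. Re (beta_weight b d t) * t ^ n) = 0" for n
      using has_integral_linear[OF int0[of n] bounded_linear_Re]
      by (auto simp: o_def integral_unique simp flip: of_real_power)
  qed auto
  moreover have "Im (beta_weight b d (1/2)) = 0"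
  proof (rule continuous_real_moments_zero[where h = "\<lambda>t. Im (beta_weight b d t)"])
    show "continuous_on {0..1} (\<lambda>t. Im (beta_weight b d t))"
      by (intro continuous_intros continuous_on_beta_weight assms)
    show "integral {0..1} (\<lambda>t. Im (beta_weight b d t) * t ^ n) = 0" for n
      using has_integral_linear[OF int0[of n] bounded_linear_Im]
      by (auto simp: o_def integral_unique simp flip: of_real_power)
  qed auto
  ultimately have "beta_weight b d (1/2) = 0" by (simp add: complex_eq_iff)
  then show False by (simp add: beta_weight_def)
qed

text \<open>The moments satisfy (c)_n M n = (b)_n M 0, so Euler's integral divided by
  \<open>M 0\<close> has the Gauss coefficients. Normalizing by \<open>M 0\<close> itself requires
  only that it is nonzero, not its expression by Gamma functions.\<close>

lemma gauss_fps_extension_euler: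
  assumes "Re b > 1" "Re (c - b) > 1"
  shows "\<exists>f. f holomorphic_on hyp_domain \<and> f has_fps_expansion gauss_fps a b c"
proof -
  define h where "h = beta_weight b (c - b)"
  define M where "M = (\<lambda>n. integral {0..1} (\<lambda>t. h t * of_real t ^ n))"
  have h: "continuous_on {0..1} h"
    unfolding h_def by (intro continuous_on_beta_weight assms)
  have M0: "M 0 \<noteq> 0" using beta_weight_integral_nonzero[OF assms] by (simp add: M_def h_def)
  define f where "f = (\<lambda>w. rGamma c / M 0 * euler_integral h a 0 w)"
  have f: "f holomorphic_on hyp_domain"
    unfolding f_def by (intro holomorphic_intros holomorphic_on_euler_integral h)
  have e: "euler_integral h a 0 has_fps_expansion fps_expansion (euler_integral h a 0) 0"
    by (rule has_fps_expansion_fps_expansion[OF open_hyp_domain]) (auto intro: holomorphic_on_euler_integral h)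
  have "f has_fps_expansion fps_const (rGamma c / M 0) * fps_expansion (euler_integral h a 0) 0"
    unfolding f_def by (intro fps_expansion_intros e)
  also have "fps_const (rGamma c / M 0) * fps_expansion (euler_integral h a 0) 0 = gauss_fps a b c"
  proof (rule fps_ext)
    fix n
    have c: "c \<notin> \<int>\<^sub>\<le>\<^sub>0" using assms by (auto elim!: nonpos_Ints_cases)
    then have p: "pochhammer c n \<noteq> 0" by (auto simp: pochhammer_eq_0_iff)
    have "euler_integral h (a + of_nat n) n 0 = M n" by (simp add: euler_integral_def M_def)
    moreover have "pochhammer c n * M n = pochhammer b n * M 0"
      using beta_weight_moment[OF assms, of n] by (simp add: M_def h_def)
    ultimately show "fps_nth (fps_const (rGamma c / M 0) * fps_expansion (euler_integral h a 0) 0) n = fps_nth (gauss_fps a b c) n"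
      using M0 p by (simp add: fps_expansion_def higher_deriv_euler_integral[OF h] rGamma_add_of_nat[OF c] field_simps)
  qed
  finally show ?thesis using f by (intro exI[of _ f] conjI)
qed

lemma gauss_fps_extension_lower_denominator:
  assumes "f holomorphic_on hyp_domain" "f has_fps_expansion gauss_fps a b (c + 1)"
  shows "\<exists>g. g holomorphic_on hyp_domain \<and> g has_fps_expansion gauss_fps a b c"
proof (intro exI conjI)
  show "(\<lambda>w. w * deriv f w + c * f w) holomorphic_on hyp_domain"
    by (intro holomorphic_intros assms open_hyp_domain)
  show "(\<lambda>w. w * deriv f w + c * f w) has_fps_expansion gauss_fps a b c"
    by (subst gauss_fps_lower_denominator[symmetric]) (intro fps_expansion_intros assms)
qed

lemma gauss_fps_extension_lower_all:
  assumes f: "f holomorphic_on hyp_domain" "f has_fps_expansion gauss_fps (a + 1) (b + 1) (c + 1)"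
  shows "\<exists>g. g holomorphic_on hyp_domain \<and> g has_fps_expansion gauss_fps a b c"
proof -
  obtain g where g: "\<And>w. w \<in> hyp_domain \<Longrightarrow> (g has_field_derivative f w) (at w)"
    using holomorphic_starlike_primitive[of hyp_domain f "{}"] f(1) starlike_hyp_domain open_hyp_domain
    by (auto simp: holomorphic_on_imp_continuous_on holomorphic_on_imp_differentiable_at)
  \<comment> \<open>The constant of integration is the constant term of the wanted series.\<close>
  define k where "k = (\<lambda>w. a * b * (g w - g 0) + rGamma c)"
  have k': "(k has_field_derivative a * b * f w) (at w)" if "w \<in> hyp_domain" for w
    unfolding k_def using g[OF that] by (auto intro!: derivative_eq_intros)
  then have k: "k holomorphic_on hyp_domain"
    using open_hyp_domain by (auto simp: holomorphic_on_open)
  define K where "K = fps_expansion k 0"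
  have K: "k has_fps_expansion K"
    unfolding K_def by (rule has_fps_expansion_fps_expansion[OF open_hyp_domain _ k]) simp
  have "fps_deriv K = fps_const (a * b) * gauss_fps (a + 1) (b + 1) (c + 1)"
  proof (rule fps_expansion_unique_complex)
    show "(\<lambda>w. a * b * f w) has_fps_expansion fps_const (a * b) * gauss_fps (a + 1) (b + 1) (c + 1)"
      by (intro fps_expansion_intros f)
    have "eventually (\<lambda>w. deriv k w = a * b * f w) (nhds 0)"
      using eventually_nhds_in_open[OF open_hyp_domain zero_in_hyp_domain]
      by eventually_elim (rule DERIV_imp_deriv[OF k'])
    then show "(\<lambda>w. a * b * f w) has_fps_expansion fps_deriv K"
      using has_fps_expansion_deriv[OF K] by (subst (asm) has_fps_expansion_cong) auto
  qed
  moreover have "fps_nth K 0 = fps_nth (gauss_fps a b c) 0"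
    by (simp add: K_def fps_expansion_def k_def)
  ultimately have "K = gauss_fps a b c"
    by (simp add: fps_deriv_eq_iff flip: fps_deriv_gauss_fps)
  then show ?thesis using k K by (intro exI[of _ k] conjI) simp_all
qed

text \<open>
  Euler's integral needs \<open>Re b\<close> and \<open>Re (c - b)\<close> large. From there every parameter is reached by lowering \<open>c\<close>
  with a differential operator and by lowering all three parameters with a primitive; for the regularized
  series neither step divides by a quantity that may vanish.
\<close>

lemma gauss_fps_extension:
  "\<exists>f. f holomorphic_on hyp_domain \<and> f has_fps_expansion gauss_fps a b c"
proof -
  have step1: "\<exists>f. f holomorphic_on hyp_domain \<and> f has_fps_expansion gauss_fps a b c"
    if "Re b > 1" "Re (c - b) + real m > 1" for a b c m
    using that
  proof (induction m arbitrary: c)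
    case 0
    then show ?case by (intro gauss_fps_extension_euler) auto
  next
    case (Suc m)
    have "\<exists>f. f holomorphic_on hyp_domain \<and> f has_fps_expansion gauss_fps a b (c + 1)"
      by (rule Suc.IH) (use Suc.prems in auto)
    then show ?case by (elim exE conjE) (rule gauss_fps_extension_lower_denominator)
  qed
  have step2: "\<exists>f. f holomorphic_on hyp_domain \<and> f has_fps_expansion gauss_fps a b c"
    if "Re b > 1" for a b c
  proof -
    obtain m where "real m > 1 - Re (c - b)" using reals_Archimedean2 by blast
    then show ?thesis by (intro step1[of b c m] that) auto
  qed
  have step3: "\<exists>f. f holomorphic_on hyp_domain \<and> f has_fps_expansion gauss_fps a b c"
    if "Re b + real m > 1" for m
    using that
  proof (induction m arbitrary: a b c)
    case 0
    then show ?case by (intro step2) auto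
  next
    case (Suc m)
    have "\<exists>f. f holomorphic_on hyp_domain \<and> f has_fps_expansion gauss_fps (a + 1) (b + 1) (c + 1)"
      by (rule Suc.IH) (use Suc.prems in auto)
    then show ?case by (elim exE conjE) (rule gauss_fps_extension_lower_all)
  qed
  obtain m where "real m > 1 - Re b" using reals_Archimedean2 by blast
  then show ?thesis by (intro step3[of m]) auto
qed

section \<open>Consequences of the continuation for the hypergeometric functions\<close>

lemma analytic_ext_eq:
  assumes f: "f holomorphic_on D" "\<And>t. t \<in> A \<Longrightarrow> f t = g t"
    and D: "open D" "connected D" "A \<subseteq> D" "\<xi> \<in> D" "\<xi> islimpt A" and z: "z \<in> D"
  shows "analytic_ext D A g z = f z"
  unfolding analytic_ext_def
proof (rule the_equality)
  show "\<exists>h. h holomorphic_on D \<and> (\<forall>t\<in>A. h t = g t) \<and> h z = f z"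
    using f by (intro exI[of _ f]) auto
next
  fix y assume "\<exists>h. h holomorphic_on D \<and> (\<forall>t\<in>A. h t = g t) \<and> h z = y"
  then obtain h where h: "h holomorphic_on D" "\<And>t. t \<in> A \<Longrightarrow> h t = g t" "h z = y" by auto
  \<comment> \<open>Two candidates differ by a holomorphic function that vanishes on A, and A
    accumulates at a point of the connected set D. This uniqueness gives the definite description
    its value.\<close>
  have "h z - f z = 0"
    by (rule analytic_continuation[of "\<lambda>z. h z - f z" D A \<xi> z])
       (use assms h in \<open>auto intro!: holomorphic_intros\<close>)
  then show "y = f z" using h(3) by simp
qed

text \<open>Carries identities from formal power series to the whole slit plane, so that
  differential equations and transformations need only be checked on coefficients.\<close>

lemma fps_expansion_identity_hyp_domain:
  assumes "f holomorphic_on hyp_domain" "g holomorphic_on hyp_domain"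
    and "f has_fps_expansion F" "g has_fps_expansion F" "w \<in> hyp_domain"
  shows "f w = g w"
proof -
  have "(\<lambda>w. f w - g w) has_fps_expansion F - F"
    by (intro fps_expansion_intros assms)
  then have "f w - g w = 0"
    by (intro has_fps_expansion_0_analytic_continuation[of "\<lambda>w. f w - g w" hyp_domain])
       (auto intro!: holomorphic_intros assms open_hyp_domain connected_hyp_domain)
  then show ?thesis by simp
qed

lemma gauss_extension_sums:
  assumes "f holomorphic_on hyp_domain" "f has_fps_expansion gauss_fps a b c" "w \<in> ball 0 1"
  shows "(\<lambda>n. pochhammer a n * pochhammer b n * rGamma (c + of_nat n) * (w ^ n / fact n)) sums f w"
  using has_fps_expansion_imp_sums_complex[of f "gauss_fps a b c" 1 w] assms
    holomorphic_on_subset[OF assms(1) ball_subset_hyp_domain]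
  by (simp add: one_ereal_def)

lemma analytic_ext_hyp_domain_eq:
  assumes "f holomorphic_on hyp_domain" "\<And>w. w \<in> ball 0 1 \<Longrightarrow> f w = g w" "w \<in> hyp_domain"
  shows "analytic_ext hyp_domain (ball 0 1) g w = f w"
  using assms
  by (intro analytic_ext_eq[where \<xi> = 0] open_hyp_domain connected_hyp_domain ball_subset_hyp_domain)
     (auto simp: islimpt_ball)

lemma hyp2F1_reg_eq_extension:
  assumes "f holomorphic_on hyp_domain" "f has_fps_expansion gauss_fps a b c" "w \<in> hyp_domain"
  shows "hyp2F1_reg a b c w = f w"
  unfolding hyp2F1_reg_def
  using gauss_extension_sums[OF assms(1,2)] assms
  by (intro analytic_ext_hyp_domain_eq) (auto simp: sums_iff)

lemma holomorphic_on_hyp2F1_reg: "hyp2F1_reg a b c holomorphic_on hyp_domain"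
proof -
  obtain f where f: "f holomorphic_on hyp_domain" "f has_fps_expansion gauss_fps a b c"
    using gauss_fps_extension by blast
  have "hyp2F1_reg a b c holomorphic_on hyp_domain \<longleftrightarrow> f holomorphic_on hyp_domain"
    by (intro holomorphic_cong refl hyp2F1_reg_eq_extension f)
  with f show ?thesis by simp
qed

lemma hyp2F1_reg_has_fps_expansion [fps_expansion_intros]:
  "hyp2F1_reg a b c has_fps_expansion gauss_fps a b c"
proof -
  obtain f where f: "f holomorphic_on hyp_domain" "f has_fps_expansion gauss_fps a b c"
    using gauss_fps_extension by blast
  have "eventually (\<lambda>w. hyp2F1_reg a b c w = f w) (nhds 0)"
    using eventually_nhds_in_open[OF open_hyp_domain zero_in_hyp_domain]
    by eventually_elim (rule hyp2F1_reg_eq_extension[OF f])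
  then show ?thesis using f(2) by (subst has_fps_expansion_cong) auto
qed

lemma hyp2F1_reg_sums:
  assumes "norm w < 1"
  shows "(\<lambda>n. fps_nth (gauss_fps a b c) n * w ^ n) sums hyp2F1_reg a b c w"
  using gauss_extension_sums[OF holomorphic_on_hyp2F1_reg hyp2F1_reg_has_fps_expansion, of w] assms
  by simp

lemma hyp2F1_conv_reg:
  assumes c: "c \<notin> \<int>\<^sub>\<le>\<^sub>0" and w: "w \<in> hyp_domain"
  shows "hyp2F1 a b c w = Gamma c * hyp2F1_reg a b c w"
  unfolding hyp2F1_def
proof (rule analytic_ext_hyp_domain_eq[OF _ _ w])
  show "(\<lambda>w. Gamma c * hyp2F1_reg a b c w) holomorphic_on hyp_domain"
    by (intro holomorphic_intros holomorphic_on_hyp2F1_reg)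
  fix w :: complex assume w: "w \<in> ball 0 1"
  have g: "Gamma c * rGamma c = 1"
    using c by (simp add: rGamma_inverse_Gamma Gamma_eq_zero_iff)
  have "Gamma c * (x * rGamma (c + of_nat n) * y) = x / pochhammer c n * y" for x y n
  proof -
    have "Gamma c * (x * rGamma (c + of_nat n) * y) = (Gamma c * rGamma c) * (x / pochhammer c n * y)"
      by (simp add: rGamma_add_of_nat[OF c])
    then show ?thesis by (simp add: g)
  qed
  then have "(\<lambda>n. pochhammer a n * pochhammer b n / pochhammer c n * (w ^ n / fact n)) sums (Gamma c * hyp2F1_reg a b c w)"
    using sums_mult[OF gauss_extension_sums[OF holomorphic_on_hyp2F1_reg hyp2F1_reg_has_fps_expansion w], of "Gamma c" a b c]
    by simp
  then show "Gamma c * hyp2F1_reg a b c w = (\<Sum>n. pochhammer a n * pochhammer b n / pochhammer c n * (w ^ n / fact n))"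
    by (simp add: sums_iff)
qed

lemma hyp2F1_reg_commute: "hyp2F1_reg a b c = hyp2F1_reg b a c"
  by (simp add: hyp2F1_reg_def mult_ac)

lemma hyp2F1_reg_0 [simp]: "hyp2F1_reg a b c 0 = rGamma c"
  using has_fps_expansion_imp_0_eq_fps_nth_0[OF hyp2F1_reg_has_fps_expansion[of a b c]] by simp

lemma hyp2F1_reg_raise_left:
  assumes "w \<in> hyp_domain"
  shows "w * deriv (hyp2F1_reg a b c) w + a * hyp2F1_reg a b c w = a * hyp2F1_reg (a + 1) b c w"
proof (rule fps_expansion_identity_hyp_domain[OF _ _ _ _ assms])
  show "(\<lambda>w. w * deriv (hyp2F1_reg a b c) w + a * hyp2F1_reg a b c w) holomorphic_on hyp_domain"
    by (intro holomorphic_intros holomorphic_on_hyp2F1_reg open_hyp_domain)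
  show "(\<lambda>w. a * hyp2F1_reg (a + 1) b c w) holomorphic_on hyp_domain"
    by (intro holomorphic_intros holomorphic_on_hyp2F1_reg open_hyp_domain)
  show "(\<lambda>w. a * hyp2F1_reg (a + 1) b c w) has_fps_expansion fps_const a * gauss_fps (a + 1) b c"
    by (intro fps_expansion_intros)
  show "(\<lambda>w. w * deriv (hyp2F1_reg a b c) w + a * hyp2F1_reg a b c w) has_fps_expansion fps_const a * gauss_fps (a + 1) b c"
    by (subst gauss_fps_raise_left[symmetric]) (intro fps_expansion_intros)
qed

lemma hyp2F1_reg_ODE:
  assumes "w \<in> hyp_domain"
  shows "w * (1 - w) * deriv (deriv (hyp2F1_reg a b c)) w
    + (c - (a + b + 1) * w) * deriv (hyp2F1_reg a b c) w - a * b * hyp2F1_reg a b c w = 0"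
proof (rule fps_expansion_identity_hyp_domain[OF _ _ _ _ assms])
  let ?F = "hyp2F1_reg a b c"
  show "(\<lambda>w. w * (1 - w) * deriv (deriv ?F) w + (c - (a + b + 1) * w) * deriv ?F w - a * b * ?F w) holomorphic_on hyp_domain"
    by (intro holomorphic_intros holomorphic_on_hyp2F1_reg open_hyp_domain)
  have "(\<lambda>w. w * (1 - w) * deriv (deriv ?F) w + (c - (a + b + 1) * w) * deriv ?F w - (a * b) * ?F w) has_fps_expansion
     fps_X * (1 - fps_X) * fps_deriv (fps_deriv (gauss_fps a b c))
    + (fps_const c - fps_const (a + b + 1) * fps_X) * fps_deriv (gauss_fps a b c) - fps_const (a * b) * gauss_fps a b c"
    by (intro fps_expansion_intros)
  then show "(\<lambda>w. w * (1 - w) * deriv (deriv ?F) w + (c - (a + b + 1) * w) * deriv ?F w - a * b * ?F w) has_fps_expansion 0"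
    by (simp only: gauss_fps_ODE)
qed auto

section \<open>Pfaff's transformation\<close>

lemma pochhammer_vandermonde:
  "(\<Sum>m\<le>n. (-1) ^ m * of_nat (n choose m) * pochhammer x m * pochhammer (c + of_nat m) (n - m))
     = pochhammer (c - x :: complex) n"
proof -
  have "(-1) ^ m * of_nat (n choose m) * pochhammer x m * pochhammer (c + of_nat m) (n - m)
     = (-1) ^ n * (of_nat (n choose m) * pochhammer x m * pochhammer (1 - c - of_nat n) (n - m))"
    if "m \<le> n" for m
  proof -
    \<comment> \<open>Reversing the factors of (c + m)_(n-m) gives, up to sign, a Pochhammer symbol
      whose base does not depend on m, as the Chu-Vandermonde sum requires.\<close>
    have "pochhammer (1 - c - of_nat n) (n - m) = (-1) ^ (n - m) * pochhammer (c + of_nat m) (n - m)"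
      using pochhammer_minus[of "c + of_nat n - 1" "n - m"] that by (simp add: of_nat_diff algebra_simps)
    moreover have "(-1) ^ n = (-1) ^ m * (-1 :: complex) ^ (n - m)"
      using that by (simp flip: power_add)
    ultimately show ?thesis by (simp add: mult_ac flip: power_mult_distrib)
  qed
  then have "(\<Sum>m\<le>n. (-1) ^ m * of_nat (n choose m) * pochhammer x m * pochhammer (c + of_nat m) (n - m))
     = (-1) ^ n * pochhammer (x + (1 - c - of_nat n)) n"
    by (simp add: pochhammer_binomial_sum sum_distrib_left)
  also have "\<dots> = pochhammer (c - x) n"
    using pochhammer_minus[of "c + of_nat n - 1 - x" n] by (simp add: algebra_simps flip: power_mult_distrib mult.assoc)
  finally show ?thesis .
qed

definition neg_binomial_fps :: "complex \<Rightarrow> complex fps" where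
  "neg_binomial_fps a = Abs_fps (\<lambda>n. pochhammer a n / fact n)"

lemma has_fps_expansion_neg_binomial:
  "(\<lambda>w. (1 - w) powr (-a)) has_fps_expansion neg_binomial_fps a"
proof (rule has_fps_expansionI)
  have "eventually (\<lambda>w::complex. w \<in> ball 0 1) (nhds 0)"
    by (intro eventually_nhds_in_open) auto
  then show "\<forall>\<^sub>F w in nhds 0. (\<lambda>n. fps_nth (neg_binomial_fps a) n * w ^ n) sums (1 - w) powr (-a)"
  proof eventually_elim
    case (elim w)
    then have "(\<lambda>n. ((-a) gchoose n) * (-w) ^ n) sums (1 + (-w)) powr (-a)"
      by (intro gen_binomial_complex) simp
    moreover have "((-a) gchoose n) * (-w) ^ n = fps_nth (neg_binomial_fps a) n * w ^ n" for n
      by (subst power_minus) (simp add: neg_binomial_fps_def gbinomial_pochhammer)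
    ultimately show ?case by simp
  qed
qed

text \<open>The exponents of 1 - w add on the unit disc, where 1 - w is nonzero; uniqueness of
  expansions gives the formal identity without a convolution of coefficients.\<close>

lemma neg_binomial_fps_mult: "neg_binomial_fps a * neg_binomial_fps b = neg_binomial_fps (a + b)"
proof (rule fps_expansion_unique_complex)
  show "(\<lambda>w. (1 - w) powr (-a) * (1 - w) powr (-b)) has_fps_expansion neg_binomial_fps a * neg_binomial_fps b"
    by (intro fps_expansion_intros has_fps_expansion_neg_binomial)
  have "eventually (\<lambda>w::complex. w \<in> ball 0 1) (nhds 0)"
    by (intro eventually_nhds_in_open) auto
  then have "eventually (\<lambda>w::complex. (1 - w) powr (-a) * (1 - w) powr (-b) = (1 - w) powr (-(a + b))) (nhds 0)"
    by eventually_elim (auto simp flip: powr_add)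
  then show "(\<lambda>w. (1 - w) powr (-a) * (1 - w) powr (-b)) has_fps_expansion neg_binomial_fps (a + b)"
    using has_fps_expansion_neg_binomial[of "a + b"] by (subst has_fps_expansion_cong) auto
qed

lemma neg_binomial_fps_power: "neg_binomial_fps 1 ^ n = neg_binomial_fps (of_nat n)"
proof (induction n)
  case 0
  show ?case by (simp add: neg_binomial_fps_def fps_eq_iff pochhammer_0_left)
next
  case (Suc n)
  then show ?case by (simp add: neg_binomial_fps_mult)
qed

text \<open>The inner series is w/(w - 1) = -w (1-w)^(-1); its mth power times (1-w)^(-a) is (-1)^m
  w^m (1-w)^(-a-m). The coefficient of w^n is then (a)_n / (n! Gamma(c + n)) times an alternating
  Vandermonde sum with x = c - b, which equals (b)_n.\<close>

lemma gauss_fps_pfaff: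
  "neg_binomial_fps a * (gauss_fps a (c - b) c oo (- fps_X * neg_binomial_fps 1)) = gauss_fps a b c"
proof (rule fps_ext)
  fix n
  define S T where "S = gauss_fps a (c - b) c" and "T = - fps_X * neg_binomial_fps 1"
  have T_power: "T ^ m = fps_const ((-1) ^ m) * (fps_X ^ m * neg_binomial_fps (of_nat m))" for m
  proof -
    have "T = fps_const (-1) * (fps_X * neg_binomial_fps 1)" by (simp add: T_def flip: fps_const_neg)
    then show ?thesis by (simp only: power_mult_distrib neg_binomial_fps_power fps_const_power)
  qed
  have "fps_nth (neg_binomial_fps a * (S oo T)) n
    = (\<Sum>i\<le>n. fps_nth (neg_binomial_fps a) i * (\<Sum>m\<le>n - i. fps_nth S m * fps_nth (T ^ m) (n - i)))"
    by (simp add: fps_mult_nth fps_compose_nth atMost_atLeast0)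
  \<comment> \<open>\<open>T ^ m\<close> starts with X^m, so the added terms with m > n - i vanish;
    a range that does not depend on i allows the sums to be exchanged.\<close>
  also have "\<dots> = (\<Sum>i\<le>n. fps_nth (neg_binomial_fps a) i * (\<Sum>m\<le>n. fps_nth S m * fps_nth (T ^ m) (n - i)))"
    by (intro sum.cong refl arg_cong2[where f = "(*)"] sum.mono_neutral_left) (auto simp: T_power fps_X_power_mult_nth)
  also have "\<dots> = (\<Sum>m\<le>n. fps_nth S m * (\<Sum>i\<le>n. fps_nth (neg_binomial_fps a) i * fps_nth (T ^ m) (n - i)))"
    by (simp add: sum_distrib_left mult_ac) (rule sum.swap)
  also have "\<dots> = (\<Sum>m\<le>n. fps_nth S m * fps_nth (neg_binomial_fps a * T ^ m) n)"
    by (simp add: fps_mult_nth atMost_atLeast0)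
  also have "\<dots> = (\<Sum>m\<le>n. pochhammer a n * rGamma (c + of_nat n) / fact n *
      ((-1) ^ m * of_nat (n choose m) * pochhammer (c - b) m * pochhammer (c + of_nat m) (n - m)))"
  proof (rule sum.cong[OF refl])
    fix m assume "m \<in> {..n}"
    then have m: "m \<le> n" by simp
    have "neg_binomial_fps a * T ^ m = fps_const ((-1) ^ m) * (fps_X ^ m * neg_binomial_fps (a + of_nat m))"
      by (simp add: T_power mult_ac flip: neg_binomial_fps_mult)
    then have 1: "fps_nth (neg_binomial_fps a * T ^ m) n = (-1) ^ m * (pochhammer (a + of_nat m) (n - m) / fact (n - m))"
      using m by (simp add: fps_X_power_mult_nth neg_binomial_fps_def)
    have 2: "pochhammer a n = pochhammer a m * pochhammer (a + of_nat m) (n - m)"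
      using m by (rule pochhammer_product)
    have 3: "rGamma (c + of_nat m) = pochhammer (c + of_nat m) (n - m) * rGamma (c + of_nat n)"
      using pochhammer_rGamma[of "c + of_nat m" "n - m"] m by (simp add: of_nat_diff)
    have 4: "of_nat (n choose m) = fact n / (fact m * fact (n - m) :: complex)"
      using m by (rule binomial_fact)
    show "fps_nth S m * fps_nth (neg_binomial_fps a * T ^ m) n = pochhammer a n * rGamma (c + of_nat n) / fact n *
      ((-1) ^ m * of_nat (n choose m) * pochhammer (c - b) m * pochhammer (c + of_nat m) (n - m))"
      unfolding 1 2 4 by (simp add: S_def 3)
  qed
  also have "\<dots> = pochhammer a n * rGamma (c + of_nat n) / fact n * pochhammer b n"
    by (simp only: sum_distrib_left[symmetric] pochhammer_vandermonde) simp
  finally show "fps_nth (neg_binomial_fps a * (S oo T)) n = fps_nth (gauss_fps a b c) n"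
    by simp
qed

lemma pfaff_argument:
  assumes "w \<in> hyp_domain"
  shows "w / (w - 1) \<in> hyp_domain"
proof -
  from assms have w: "w \<noteq> 1" "1 - w \<notin> \<real>\<^sub>\<le>\<^sub>0" by (auto simp: mem_hyp_domain_iff)
  have "1 - w / (w - 1) = inverse (1 - w)" using w(1) by (simp add: field_simps)
  then show ?thesis using w(2) by (simp add: mem_hyp_domain_iff)
qed

theorem hyp2F1_reg_pfaff:
  assumes "w \<in> hyp_domain"
  shows "hyp2F1_reg a b c w = (1 - w) powr (-a) * hyp2F1_reg a (c - b) c (w / (w - 1))"
proof (rule fps_expansion_identity_hyp_domain[OF _ _ _ _ assms])
  let ?g = "\<lambda>w. (1 - w) powr (-a) * hyp2F1_reg a (c - b) c (w / (w - 1))"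
  have "(\<lambda>w. w / (w - 1)) holomorphic_on hyp_domain"
    by (intro holomorphic_intros) (auto simp: mem_hyp_domain_iff)
  moreover have "(\<lambda>w. w / (w - 1)) ` hyp_domain \<subseteq> hyp_domain"
    using pfaff_argument by blast
  ultimately have "hyp2F1_reg a (c - b) c \<circ> (\<lambda>w. w / (w - 1)) holomorphic_on hyp_domain"
    by (intro holomorphic_on_compose_gen[OF _ holomorphic_on_hyp2F1_reg])
  then show "?g holomorphic_on hyp_domain"
    by (intro holomorphic_intros) (auto simp: mem_hyp_domain_iff o_def)
  have "(\<lambda>w. -w * (1 - w) powr (-1)) has_fps_expansion - fps_X * neg_binomial_fps 1"
    by (intro fps_expansion_intros has_fps_expansion_neg_binomial)
  \<comment> \<open>At w = 1 both sides are 0 by convention, so the functions agree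
    everywhere.\<close>
  moreover have "(1 - w) powr (-1) = inverse (1 - w)" for w :: complex
    by (cases "w = 1") (auto simp: powr_minus)
  then have "-w * (1 - w) powr (-1) = w / (w - 1)" for w :: complex
    by (cases "w = 1") (auto simp: field_simps)
  ultimately have T: "(\<lambda>w. w / (w - 1)) has_fps_expansion - fps_X * neg_binomial_fps 1"
    by simp
  have "(\<lambda>w. (1 - w) powr (-a) * (hyp2F1_reg a (c - b) c \<circ> (\<lambda>w. w / (w - 1))) w) has_fps_expansion
     neg_binomial_fps a * (gauss_fps a (c - b) c oo (- fps_X * neg_binomial_fps 1))"
    by (intro has_fps_expansion_mult has_fps_expansion_neg_binomial has_fps_expansion_compose T
        hyp2F1_reg_has_fps_expansion) simp
  then show "?g has_fps_expansion gauss_fps a b c"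
    by (simp only: gauss_fps_pfaff o_def)
qed (intro holomorphic_on_hyp2F1_reg hyp2F1_reg_has_fps_expansion)+

section \<open>Gauss's summation theorem\<close>

lemma summable_norm_gauss_fps:
  assumes "Re (c - a - b) > 0"
  shows "summable (\<lambda>n. norm (fps_nth (gauss_fps a b c) n))"
proof (rule summable_norm_comparison_bigo[OF gauss_fps_nth_bigo])
  show "summable (\<lambda>n. \<bar>real n powr (Re (a + b - c) - 1)\<bar>)"
    using assms by (simp add: summable_real_powr_iff)
qed

text \<open>Termwise the difference of the two sides is U n - U (n + 1), with U n equal to n times
  the nth coefficient. The sum telescopes, and U tends to 0 because the coefficients are of order
  n^(p-1) with p = Re (a + b - c) < 0.\<close>

lemma gauss_sum_recurrence:
  assumes "Re (c - a - b) > 0"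
  shows "(c - a - b) * suminf (fps_nth (gauss_fps a b c)) = (c - a) * (c - b) * suminf (fps_nth (gauss_fps a b (c + 1)))"
proof -
  define s t where "s = fps_nth (gauss_fps a b c)" and "t = fps_nth (gauss_fps a b (c + 1))"
  have s: "s sums suminf s"
    unfolding s_def by (rule summable_sums, rule summable_norm_cancel, rule summable_norm_gauss_fps[OF assms])
  have t: "t sums suminf t"
    unfolding t_def
    by (rule summable_sums, rule summable_norm_cancel, rule summable_norm_gauss_fps) (use assms in auto)
  have st: "s n = (c + of_nat n) * t n" for n
    using rGamma_plus1[of "c + of_nat n"] by (simp add: s_def t_def add_ac)
  have rec: "(of_nat n + 1) * (c + of_nat n + 1) * t (Suc n) = (a + of_nat n) * (b + of_nat n) * t n" for n
  proof -
    have "(1 + of_nat n :: complex) \<noteq> 0" using of_nat_neq_0[of n, where 'a = complex] by simp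
    moreover have "(c + of_nat n + 1) * rGamma (c + of_nat n + 1 + 1) = rGamma (c + of_nat n + 1)"
      by (rule rGamma_plus1)
    then have "rGamma (c + 1 + of_nat n) = (c + of_nat n + 1) * rGamma (c + 1 + of_nat (Suc n))"
      by (simp add: add_ac)
    ultimately show ?thesis
      by (simp add: t_def pochhammer_rec' add_ac divide_simps)
  qed
  define U where "U = (\<lambda>n. of_nat n * s n)"
  have "U \<longlonglongrightarrow> 0"
  proof -
    define p where "p = Re (a + b - c)"
    have p: "p < 0" using assms by (simp add: p_def)
    have "U \<in> O(\<lambda>n. of_nat n * complex_of_real (real n powr (p - 1)))"
      unfolding U_def s_def p_def by (intro landau_o.big_mult gauss_fps_nth_bigo) auto
    moreover have "(\<lambda>n. of_nat n * complex_of_real (real n powr (p - 1))) \<in> o(\<lambda>_. 1)"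
    proof (subst landau_o.small.norm_iff[symmetric])
      have "(\<lambda>n. real n * real n powr (p - 1)) \<in> o(\<lambda>_. 1 :: real)"
        using p by real_asymp
      then show "(\<lambda>n. norm (of_nat n * complex_of_real (real n powr (p - 1)))) \<in> o(\<lambda>_. norm (1 :: complex))"
        by (simp add: norm_mult)
    qed
    ultimately have "U \<in> o(\<lambda>_. 1)" by (rule landau_o.big_small_trans)
    then show ?thesis by (auto dest: smalloD_tendsto)
  qed
  then have U: "(\<lambda>n. U n - U (Suc n)) sums (U 0 - 0)" by (rule telescope_sums')
  have "U n - U (Suc n) = (c - a - b) * s n - (c - a) * (c - b) * t n" for n
  proof -
    have "U n - U (Suc n) = of_nat n * (c + of_nat n) * t n - (of_nat n + 1) * (c + of_nat n + 1) * t (Suc n)"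
      by (simp add: U_def st algebra_simps)
    also have "\<dots> = (c - a - b) * s n - (c - a) * (c - b) * t n"
      unfolding rec st by (simp add: algebra_simps)
    finally show ?thesis .
  qed
  with U have "(\<lambda>n. (c - a - b) * s n - (c - a) * (c - b) * t n) sums 0"
    by (simp add: U_def)
  moreover have "(\<lambda>n. (c - a - b) * s n - (c - a) * (c - b) * t n) sums ((c - a - b) * suminf s - (c - a) * (c - b) * suminf t)"
    by (intro sums_diff sums_mult s t)
  ultimately show ?thesis unfolding s_def t_def
    by (metis (no_types, lifting) sums_unique2 right_minus_eq)
qed

lemma gauss_sum_shift:
  assumes "Re (c - a - b) > 0"
  shows "pochhammer (c - a - b) n * suminf (fps_nth (gauss_fps a b c))
     = pochhammer (c - a) n * pochhammer (c - b) n * suminf (fps_nth (gauss_fps a b (c + of_nat n)))"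
proof (induction n)
  case (Suc n)
  have "(c + of_nat n - a - b) * suminf (fps_nth (gauss_fps a b (c + of_nat n)))
     = (c + of_nat n - a) * (c + of_nat n - b) * suminf (fps_nth (gauss_fps a b (c + of_nat n + 1)))"
    by (rule gauss_sum_recurrence) (use assms in auto)
  then have step: "(c - a - b + of_nat n) * suminf (fps_nth (gauss_fps a b (c + of_nat n)))
     = (c - a + of_nat n) * (c - b + of_nat n) * suminf (fps_nth (gauss_fps a b (c + of_nat (Suc n))))"
    by (simp add: algebra_simps)
  have "pochhammer (c - a - b) (Suc n) * suminf (fps_nth (gauss_fps a b c))
    = (c - a - b + of_nat n) * (pochhammer (c - a - b) n * suminf (fps_nth (gauss_fps a b c)))"
    by (simp only: pochhammer_rec' mult_ac)
  also have "\<dots> = pochhammer (c - a) n * pochhammer (c - b) n *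
      ((c - a - b + of_nat n) * suminf (fps_nth (gauss_fps a b (c + of_nat n))))"
    unfolding Suc by (simp only: mult_ac)
  also have "\<dots> = pochhammer (c - a) (Suc n) * pochhammer (c - b) (Suc n) * suminf (fps_nth (gauss_fps a b (c + of_nat (Suc n))))"
    unfolding step by (simp only: pochhammer_rec' mult_ac)
  finally show ?case .
qed simp

lemma norm_pochhammer_ge:
  assumes "0 < r" "r \<le> Re z"
  shows "pochhammer r n \<le> norm (pochhammer z n)"
  unfolding pochhammer_prod prod_norm[symmetric]
proof (rule prod_mono, safe)
  fix i :: nat
  show "0 \<le> r + of_nat i" using assms by simp
  show "r + of_nat i \<le> norm (z + of_nat i)"
    using complex_Re_le_cmod[of "z + of_nat i"] assms by simp
qed

text \<open>As the denominator parameter grows, every term with k > 0 tends to 0 and the term k = 0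
  is always 1; Tannery's theorem allows the limit to be taken termwise.\<close>

lemma gauss_series_large_denominator:
  "(\<lambda>n. \<Sum>k. pochhammer a k * pochhammer b k / fact k * inverse (pochhammer (c + of_nat n) k)) \<longlonglongrightarrow> (1 :: complex)"
proof -
  define f where "f = (\<lambda>k. pochhammer a k * pochhammer b k / fact k :: complex)"
  \<comment> \<open>With this N the real number r is positive and exceeds Re (a + b), so the Gauss
    series with denominator parameter r converges absolutely at 1. Its terms dominate, up to a
    constant, those for all n beyond N.\<close>
  obtain N where N: "real N > max (- Re c) (Re (a + b - c))" using reals_Archimedean2 by blast
  define r where "r = Re c + real N"
  have r: "r > 0" "Re (of_real r - a - b) > 0" using N by (auto simp: r_def)
  \<comment> \<open>The factor 0 ^ k covers both cases of the limit, as 0 ^ 0 = 1.\<close>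
  have lim: "(\<lambda>n. f k * inverse (pochhammer (c + of_nat n) k)) \<longlonglongrightarrow> f k * 0 ^ k" for k
  proof -
    have "(\<lambda>n. inverse (c + of_nat n + of_nat i)) \<longlonglongrightarrow> 0" for i
    proof (rule filterlim_compose[OF tendsto_inverse_0])
      have "filterlim (\<lambda>n. (c + of_nat i) + of_nat n) at_infinity sequentially"
        by (rule tendsto_add_filterlim_at_infinity[OF tendsto_const tendsto_of_nat])
      then show "filterlim (\<lambda>n. c + of_nat n + of_nat i) at_infinity sequentially"
        by (simp add: add_ac)
    qed
    then have "(\<lambda>n. f k * (\<Prod>i<k. inverse (c + of_nat n + of_nat i))) \<longlonglongrightarrow> f k * (\<Prod>i<k. 0)"
      by (intro tendsto_intros)
    then show ?thesis
      by (simp add: pochhammer_prod prod_inversef atLeast0LessThan flip: prod_inversef)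
  qed
  have "eventually (\<lambda>n. \<forall>k. norm (f k * inverse (pochhammer (c + of_nat n) k)) \<le> norm (f k) / pochhammer r k) sequentially"
    using eventually_ge_at_top[of N]
  proof eventually_elim
    case (elim n)
    show ?case
    proof
      fix k
      have "pochhammer r k \<le> norm (pochhammer (c + of_nat n) k)"
        using elim r by (intro norm_pochhammer_ge) (auto simp: r_def)
      moreover have "pochhammer r k > 0" using r by (intro pochhammer_pos)
      ultimately have "norm (f k) / norm (pochhammer (c + of_nat n) k) \<le> norm (f k) / pochhammer r k"
        by (intro divide_left_mono mult_pos_pos) auto
      then show "norm (f k * inverse (pochhammer (c + of_nat n) k)) \<le> norm (f k) / pochhammer r k"
        by (simp add: norm_mult norm_inverse divide_inverse)
    qed
  qed
  then have "eventually (\<lambda>(k::nat, n). \<forall>k. norm (f k * inverse (pochhammer (c + of_nat n) k)) \<le> norm (f k) / pochhammer r k) (at_top \<times>\<^sub>F sequentially)"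
    by (subst eventually_prod2) auto
  then have bound: "eventually (\<lambda>(k, n). norm (f k * inverse (pochhammer (c + of_nat n) k)) \<le> norm (f k) / pochhammer r k) (at_top \<times>\<^sub>F sequentially)"
    by eventually_elim auto
  have "complex_of_real r \<notin> \<int>\<^sub>\<le>\<^sub>0" using r by (auto elim!: nonpos_Ints_cases simp: complex_eq_iff)
  then have eq: "norm (fps_nth (gauss_fps a b (of_real r)) k) = norm (rGamma (complex_of_real r)) * (norm (f k) / pochhammer r k)" for k
    using pochhammer_pos[OF r(1), of k]
    by (simp add: f_def rGamma_add_of_nat norm_mult norm_divide pochhammer_of_real mult_ac)
  have "norm (rGamma (complex_of_real r)) \<noteq> 0"
    using \<open>complex_of_real r \<notin> \<int>\<^sub>\<le>\<^sub>0\<close> by (simp add: rGamma_eq_zero_iff)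
  with summable_norm_gauss_fps[OF r(2)] have summ: "summable (\<lambda>k. norm (f k) / pochhammer r k)"
    unfolding eq by (rule summable_mult_D)
  have "(\<lambda>n. \<Sum>k. f k * inverse (pochhammer (c + of_nat n) k)) \<longlonglongrightarrow> (\<Sum>k. f k * 0 ^ k)"
    using tannerys_theorem[OF lim bound summ] by simp
  also have "(\<Sum>k. f k * 0 ^ k) = 1" by (simp only: powser_zero) (simp add: f_def)
  finally show ?thesis by (simp add: f_def)
qed

text \<open>The recurrence reduces the sum to its limit for \<open>c\<close> tending to infinity.\<close>

theorem gauss_sum:
  assumes "Re (c - a - b) > 0"
  shows "suminf (fps_nth (gauss_fps a b c)) = rGamma (c - a) * rGamma (c - b) * Gamma (c - a - b)"
proof -
  \<comment> \<open>For Re c > 0 the numbers c + n are not poles of Gamma and 1/Gamma(c + n) can be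
    taken out of the series. The induction on m reaches the remaining c through the recurrence,
    whose factor c - a - b is nonzero.\<close>
  have main: "suminf (fps_nth (gauss_fps a b c)) = rGamma (c - a) * rGamma (c - b) * Gamma (c - a - b)"
    if "Re (c - a - b) > 0" "Re c + real m > 0" for c m
    using that
  proof (induction m arbitrary: c)
    case 0
    define G where "G = suminf (fps_nth (gauss_fps a b c))"
    define F where "F = (\<lambda>n. \<Sum>k. pochhammer a k * pochhammer b k / fact k * inverse (pochhammer (c + of_nat n) k))"
    have nz: "c + of_nat n \<notin> \<int>\<^sub>\<le>\<^sub>0" for n using 0 by (auto elim!: nonpos_Ints_cases simp: complex_eq_iff)
    have GF: "suminf (fps_nth (gauss_fps a b (c + of_nat n))) = rGamma (c + of_nat n) * F n" for n
    proof -
      let ?g = "\<lambda>k. pochhammer a k * pochhammer b k / fact k * inverse (pochhammer (c + of_nat n) k)"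
      have eq: "fps_nth (gauss_fps a b (c + of_nat n)) = (\<lambda>k. rGamma (c + of_nat n) * ?g k)"
        by (rule ext) (simp add: rGamma_add_of_nat[OF nz] divide_inverse mult_ac)
      have "summable (fps_nth (gauss_fps a b (c + of_nat n)))"
        by (rule summable_norm_cancel, rule summable_norm_gauss_fps) (use 0 in auto)
      moreover have "rGamma (c + of_nat n) \<noteq> 0" using nz[of n] by (simp add: rGamma_eq_zero_iff)
      ultimately have "summable ?g"
        unfolding eq by (rule summable_mult_D)
      then show ?thesis unfolding eq F_def by (rule suminf_mult)
    qed
    \<comment> \<open>Both sides of the iterated recurrence are divided by the same power of n and
      two factorials, since (c - a - b) + c = (c - a) + (c - b). The Pochhammer symbols thereby
      become convergent sequences.\<close>
    have key: "rGamma_series (c - a - b) n * rGamma_series c n * G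
       = rGamma_series (c - a) n * rGamma_series (c - b) n * rGamma c * F (n + 1)" for n
    proof -
      define e where "e = (\<lambda>z. fact n * exp (z * complex_of_real (ln (real n))))"
      have e: "e (c - a - b) * e c = e (c - a) * e (c - b)" "e z \<noteq> 0" for z
        by (simp_all add: e_def algebra_simps flip: exp_add)
      have "pochhammer c (n + 1) \<noteq> 0" using nz[of 0] by (auto simp: pochhammer_eq_0_iff)
      then have "pochhammer (c - a - b) (n + 1) * pochhammer c (n + 1) * G
         = pochhammer (c - a) (n + 1) * pochhammer (c - b) (n + 1) * rGamma c * F (n + 1)"
        using gauss_sum_shift[OF 0(1), of "n + 1"] nz[of 0]
        unfolding GF by (simp add: G_def rGamma_add_of_nat nonzero_eq_divide_eq mult_ac del: of_nat_add of_nat_Suc)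
      then have "pochhammer (c - a - b) (n + 1) * pochhammer c (n + 1) * G / (e (c - a - b) * e c)
         = pochhammer (c - a) (n + 1) * pochhammer (c - b) (n + 1) * rGamma c * F (n + 1) / (e (c - a) * e (c - b))"
        by (simp only: e)
      then show ?thesis by (simp add: rGamma_series_def e_def)
    qed
    have "F \<longlonglongrightarrow> 1" unfolding F_def by (rule gauss_series_large_denominator)
    then have "(\<lambda>n. rGamma_series (c - a) n * rGamma_series (c - b) n * rGamma c * F (n + 1))
        \<longlonglongrightarrow> rGamma (c - a) * rGamma (c - b) * rGamma c * 1"
      by (intro tendsto_intros LIMSEQ_ignore_initial_segment)
    moreover have "(\<lambda>n. rGamma_series (c - a - b) n * rGamma_series c n * G)
        \<longlonglongrightarrow> rGamma (c - a - b) * rGamma c * G"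
      by (intro tendsto_intros)
    ultimately have "rGamma (c - a - b) * rGamma c * G = rGamma (c - a) * rGamma (c - b) * rGamma c"
      unfolding key using LIMSEQ_unique by fastforce
    moreover have "rGamma c \<noteq> 0" using nz[of 0] by (simp add: rGamma_eq_zero_iff)
    ultimately have 1: "rGamma (c - a - b) * G = rGamma (c - a) * rGamma (c - b)" by simp
    have 2: "Gamma (c - a - b) * rGamma (c - a - b) = 1"
    proof -
      have "c - a - b \<notin> \<int>\<^sub>\<le>\<^sub>0" using 0(1) by (auto elim!: nonpos_Ints_cases simp: complex_eq_iff)
      then show ?thesis by (simp add: rGamma_inverse_Gamma Gamma_eq_zero_iff)
    qed
    have "G = (Gamma (c - a - b) * rGamma (c - a - b)) * G" unfolding 2 by simp
    also have "\<dots> = rGamma (c - a) * rGamma (c - b) * Gamma (c - a - b)"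
      unfolding mult.assoc 1 by (simp only: mult_ac)
    finally show ?case unfolding G_def .
  next
    case (Suc m)
    have "suminf (fps_nth (gauss_fps a b (c + 1))) = rGamma (c - a + 1) * rGamma (c - b + 1) * Gamma (c - a - b + 1)"
      using Suc.IH[of "c + 1"] Suc.prems by (simp add: algebra_simps del: gauss_fps_nth)
    moreover have "(c - a - b) \<notin> \<int>\<^sub>\<le>\<^sub>0"
      using Suc.prems(1) by (auto elim!: nonpos_Ints_cases simp: complex_eq_iff)
    then have "Gamma (c - a - b + 1) = (c - a - b) * Gamma (c - a - b)"
      by (rule Gamma_plus1)
    ultimately have "(c - a - b) * suminf (fps_nth (gauss_fps a b c)) =
       (c - a - b) * (((c - a) * rGamma (c - a + 1)) * ((c - b) * rGamma (c - b + 1)) * Gamma (c - a - b))"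
      using gauss_sum_recurrence[OF Suc.prems(1)] by (simp add: mult_ac)
    moreover have "c - a - b \<noteq> 0" using Suc.prems(1) by auto
    ultimately show ?case by (simp add: rGamma_plus1 del: gauss_fps_nth)
  qed
  obtain m where "real m > - Re c" using reals_Archimedean2 by blast
  then show ?thesis using assms by (intro main[of c m]) auto
qed

text \<open>The series converges absolutely at 1 and |u^k| \<le> 1 for u in (0,1), so Tannery's
  theorem gives the limit as the sum of the coefficients.\<close>

lemma hyp2F1_reg_tendsto_at_left_1:
  assumes "Re (c - a - b) > 0"
  shows "((\<lambda>u. hyp2F1_reg a b c (of_real u)) \<longlongrightarrow> rGamma (c - a) * rGamma (c - b) * Gamma (c - a - b)) (at_left (1::real))"
proof -
  define f where "f = fps_nth (gauss_fps a b c)"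
  have u: "eventually (\<lambda>u::real. u \<in> {0<..<1}) (at_left 1)"
    by (rule eventually_at_leftI[of 0]) auto
  have lim: "((\<lambda>u. f k * of_real u ^ k) \<longlongrightarrow> f k) (at_left (1::real))" for k
    by (rule tendsto_eq_intros refl | simp)+
  have "eventually (\<lambda>(k::nat, u). u \<in> {0<..<1::real}) (at_top \<times>\<^sub>F at_left 1)"
    using u by (subst eventually_prod2) auto
  then have bound: "eventually (\<lambda>(k, u::real). norm (f k * of_real u ^ k) \<le> norm (f k)) (at_top \<times>\<^sub>F at_left 1)"
    by eventually_elim (auto simp: norm_mult norm_power intro!: mult_left_le power_le_one)
  have "((\<lambda>u::real. \<Sum>k. f k * of_real u ^ k) \<longlongrightarrow> suminf f) (at_left 1)"
    using tannerys_theorem[OF lim bound summable_norm_gauss_fps[OF assms, folded f_def]] by simp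
  moreover have "eventually (\<lambda>u::real. (\<Sum>k. f k * of_real u ^ k) = hyp2F1_reg a b c (of_real u)) (at_left 1)"
    using u
  proof eventually_elim
    case (elim u)
    then show ?case using hyp2F1_reg_sums[of "of_real u" a b c] by (simp add: f_def sums_iff)
  qed
  ultimately show ?thesis
    using gauss_sum[OF assms] by (simp add: f_def tendsto_cong)
qed

section \<open>The Gegenbauer equation\<close>

text \<open>Gegenbauer's equation of degree -s and order s - c + 1. For s = \<nu> + \<mu> + 1 and c
  = \<nu> + 3/2 the order is \<mu> + 1/2, and this is Legendre's associated equation after removal
  of the factor (1 - z^2)^(\<mu>/2). The derivative is an argument because both Wronskians and
  limits at the origin refer to it.\<close>

definition gegenbauer_solution ::
  "complex \<Rightarrow> complex \<Rightarrow> complex set \<Rightarrow> (complex \<Rightarrow> complex) \<Rightarrow> (complex \<Rightarrow> complex) \<Rightarrow> bool" where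
  "gegenbauer_solution s c S f f' \<longleftrightarrow> (\<forall>z\<in>S. (f has_field_derivative f' z) (at z)) \<and>
     (\<forall>z\<in>S. \<exists>D. (f' has_field_derivative D) (at z) \<and>
        (1 - z\<^sup>2) * D - (2 * s - 2 * c + 3) * z * f' z - s * (s - 2 * c + 2) * f z = 0)"

lemma gegenbauer_solutionI:
  assumes "\<And>z. z \<in> S \<Longrightarrow> (f has_field_derivative f' z) (at z)"
    and "\<And>z. z \<in> S \<Longrightarrow> (f' has_field_derivative f'' z) (at z)"
    and "\<And>z. z \<in> S \<Longrightarrow> (1 - z\<^sup>2) * f'' z - (2 * s - 2 * c + 3) * z * f' z - s * (s - 2 * c + 2) * f z = 0"
  shows "gegenbauer_solution s c S f f'"
  using assms unfolding gegenbauer_solution_def by blast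

lemma gegenbauer_solution_subset:
  "gegenbauer_solution s c S f f' \<Longrightarrow> T \<subseteq> S \<Longrightarrow> gegenbauer_solution s c T f f'"
  unfolding gegenbauer_solution_def by blast

lemma mem_D1_iff: "z \<in> D1 \<longleftrightarrow> Im z \<noteq> 0 \<or> \<bar>Re z\<bar> < 1"
  by (auto simp: D1_def image_iff complex_eq_iff)

lemma open_D1: "open D1"
proof -
  have eq: "D1 = {z. Im z \<noteq> 0} \<union> {z. \<bar>Re z\<bar> < 1}"
    by (auto simp: mem_D1_iff)
  show ?thesis
    unfolding eq by (intro open_Un open_Collect_neq open_Collect_less continuous_intros)
qed

lemma connected_D1: "connected D1"
proof (rule starlike_imp_connected)
  show "starlike D1"
    unfolding starlike_def
  proof (intro bexI[of _ 0] ballI subsetI)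
    fix w z assume w: "w \<in> D1" and z: "z \<in> closed_segment 0 w"
    from z obtain t where t: "t \<in> {0..1}" "z = of_real t * w"
      by (auto simp: closed_segment_def scaleR_conv_of_real)
    show "z \<in> D1"
    proof (cases "Im w = 0 \<or> t = 0")
      case True
      then have "\<bar>t\<bar> * \<bar>Re w\<bar> \<le> 1 * \<bar>Re w\<bar>" using t by (intro mult_right_mono) auto
      then show ?thesis using True w t by (auto simp: mem_D1_iff abs_mult)
    qed (use t in \<open>auto simp: mem_D1_iff\<close>)
  qed (simp add: mem_D1_iff)
qed

lemma one_minus_square_D1:
  assumes "z \<in> D1"
  shows "1 - z\<^sup>2 \<notin> \<real>\<^sub>\<le>\<^sub>0"
proof
  assume "1 - z\<^sup>2 \<in> \<real>\<^sub>\<le>\<^sub>0"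
  then have *: "1 \<le> (Re z)\<^sup>2 - (Im z)\<^sup>2" "Re z * Im z = 0"
    by (auto simp: complex_nonpos_Reals_iff power2_eq_square)
  have "Re z \<noteq> 0"
  proof
    assume "Re z = 0"
    with *(1) zero_le_power2[of "Im z"] show False by simp
  qed
  with * have "Im z = 0" "1 \<le> (Re z)\<^sup>2" by auto
  then show False using assms abs_square_less_1[of "Re z"] by (simp add: mem_D1_iff)
qed

lemma square_in_hyp_domain: "z \<in> D1 \<Longrightarrow> z\<^sup>2 \<in> hyp_domain"
  using one_minus_square_D1 by (simp add: mem_hyp_domain_iff)

lemma has_field_derivative_hyp2F1_reg:
  assumes "w \<in> hyp_domain"
  shows "(hyp2F1_reg a b c has_field_derivative deriv (hyp2F1_reg a b c) w) (at w)"
    and "(deriv (hyp2F1_reg a b c) has_field_derivative deriv (deriv (hyp2F1_reg a b c)) w) (at w)"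
  using assms open_hyp_domain holomorphic_on_hyp2F1_reg holomorphic_deriv
  by (metis holomorphic_derivI)+

lemma has_field_derivative_hyp2F1_reg_compose:
  assumes "g z \<in> hyp_domain" "(g has_field_derivative g') (at z)"
  shows "((\<lambda>z. hyp2F1_reg a b c (g z)) has_field_derivative deriv (hyp2F1_reg a b c) (g z) * g') (at z)"
    and "((\<lambda>z. deriv (hyp2F1_reg a b c) (g z)) has_field_derivative deriv (deriv (hyp2F1_reg a b c)) (g z) * g') (at z)"
  using assms by (auto intro!: DERIV_chain2[where g = g] has_field_derivative_hyp2F1_reg)

text \<open>The Gamma factors here and in \<open>odd_solution\<close> cancel the regularization, so
  that values and derivatives at 0 are those of the standard basis: 1, 0 and 0, 1.\<close>

definition even_solution :: "complex \<Rightarrow> complex \<Rightarrow> complex \<Rightarrow> complex" where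
  "even_solution s c z = Gamma (1/2) * hyp2F1_reg (s / 2) ((s - 2 * c + 2) / 2) (1 / 2) (z\<^sup>2)"

definition odd_solution :: "complex \<Rightarrow> complex \<Rightarrow> complex \<Rightarrow> complex" where
  "odd_solution s c z = Gamma (3/2) * (z * hyp2F1_reg ((s + 1) / 2) ((s - 2 * c + 3) / 2) (3 / 2) (z\<^sup>2))"

lemma even_solution_minus: "even_solution s c (-z) = even_solution s c z"
  by (simp add: even_solution_def)

lemma odd_solution_minus: "odd_solution s c (-z) = - odd_solution s c z"
  by (simp add: odd_solution_def)

text \<open>On functions of w = z^2 the Gegenbauer operator is 4 times the hypergeometric operator
  with denominator parameter 1/2.\<close>

lemma gegenbauer_even_solution:
  obtains f' where "gegenbauer_solution s c D1 (even_solution s c) f'" "f' 0 = 0"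
proof
  let ?a = "s / 2" and ?b = "(s - 2 * c + 2) / 2"
  define F where "F = hyp2F1_reg ?a ?b (1 / 2)"
  show "gegenbauer_solution s c D1 (even_solution s c) (\<lambda>z. Gamma (1/2) * (2 * z * deriv F (z\<^sup>2)))"
  proof (rule gegenbauer_solutionI)
    fix z assume "z \<in> D1"
    then have w: "z\<^sup>2 \<in> hyp_domain" by (rule square_in_hyp_domain)
    have "((\<lambda>z. z\<^sup>2) has_field_derivative 2 * z) (at z)"
      by (auto intro!: derivative_eq_intros)
    note F = has_field_derivative_hyp2F1_reg_compose[where g = "\<lambda>z. z\<^sup>2", OF w this, of ?a ?b "1/2", folded F_def]
    show "(even_solution s c has_field_derivative Gamma (1/2) * (2 * z * deriv F (z\<^sup>2))) (at z)"
      unfolding even_solution_def[abs_def] F_def[symmetric]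
      by (auto intro!: derivative_eq_intros F)
    show "((\<lambda>z. Gamma (1/2) * (2 * z * deriv F (z\<^sup>2))) has_field_derivative
        Gamma (1/2) * (2 * deriv F (z\<^sup>2) + 4 * z\<^sup>2 * deriv (deriv F) (z\<^sup>2))) (at z)"
      by (rule DERIV_cong, (rule F derivative_intros)+) (simp add: power2_eq_square algebra_simps)
    have "z\<^sup>2 * (1 - z\<^sup>2) * deriv (deriv F) (z\<^sup>2) + (1 / 2 - (?a + ?b + 1) * z\<^sup>2) * deriv F (z\<^sup>2) - ?a * ?b * F (z\<^sup>2) = 0"
      unfolding F_def by (rule hyp2F1_reg_ODE[OF w])
    then have ode: "4 * Gamma (1/2) * (z\<^sup>2 * (1 - z\<^sup>2) * deriv (deriv F) (z\<^sup>2) + (1 / 2 - (?a + ?b + 1) * z\<^sup>2) * deriv F (z\<^sup>2) - ?a * ?b * F (z\<^sup>2)) = 0"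
      by simp
    have "(1 - z\<^sup>2) * (Gamma (1/2) * (2 * deriv F (z\<^sup>2) + 4 * z\<^sup>2 * deriv (deriv F) (z\<^sup>2)))
       - (2 * s - 2 * c + 3) * z * (Gamma (1/2) * (2 * z * deriv F (z\<^sup>2))) - s * (s - 2 * c + 2) * even_solution s c z
      = 4 * Gamma (1/2) * (z\<^sup>2 * (1 - z\<^sup>2) * deriv (deriv F) (z\<^sup>2) + (1 / 2 - (?a + ?b + 1) * z\<^sup>2) * deriv F (z\<^sup>2) - ?a * ?b * F (z\<^sup>2))"
      unfolding even_solution_def F_def[symmetric] by (simp add: field_simps power2_eq_square)
    with ode show "(1 - z\<^sup>2) * (Gamma (1/2) * (2 * deriv F (z\<^sup>2) + 4 * z\<^sup>2 * deriv (deriv F) (z\<^sup>2)))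
       - (2 * s - 2 * c + 3) * z * (Gamma (1/2) * (2 * z * deriv F (z\<^sup>2))) - s * (s - 2 * c + 2) * even_solution s c z = 0"
      by simp
  qed
qed simp

text \<open>Applied to z F(z^2), the Gegenbauer operator gives 4 z times the hypergeometric operator
  with denominator parameter 3/2 on F.\<close>

lemma gegenbauer_odd_solution:
  obtains f' where "gegenbauer_solution s c D1 (odd_solution s c) f'" "f' 0 = 1"
proof
  let ?a = "(s + 1) / 2" and ?b = "(s - 2 * c + 3) / 2"
  define F where "F = hyp2F1_reg ?a ?b (3 / 2)"
  let ?f' = "\<lambda>z. Gamma (3/2) * (F (z\<^sup>2) + 2 * z\<^sup>2 * deriv F (z\<^sup>2))"
  show "gegenbauer_solution s c D1 (odd_solution s c) ?f'"
  proof (rule gegenbauer_solutionI)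
    fix z assume "z \<in> D1"
    then have w: "z\<^sup>2 \<in> hyp_domain" by (rule square_in_hyp_domain)
    have "((\<lambda>z. z\<^sup>2) has_field_derivative 2 * z) (at z)"
      by (auto intro!: derivative_eq_intros)
    note F = has_field_derivative_hyp2F1_reg_compose[where g = "\<lambda>z. z\<^sup>2", OF w this, of ?a ?b "3/2", folded F_def]
    show "(odd_solution s c has_field_derivative ?f' z) (at z)"
      unfolding odd_solution_def[abs_def] F_def[symmetric]
      by (rule DERIV_cong, (rule F derivative_intros)+) (simp add: power2_eq_square algebra_simps)
    show "(?f' has_field_derivative
        Gamma (3/2) * (6 * z * deriv F (z\<^sup>2) + 4 * z * z\<^sup>2 * deriv (deriv F) (z\<^sup>2))) (at z)"
      by (rule DERIV_cong, (rule F derivative_intros)+) (simp add: power2_eq_square algebra_simps)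
    have "z\<^sup>2 * (1 - z\<^sup>2) * deriv (deriv F) (z\<^sup>2) + (3 / 2 - (?a + ?b + 1) * z\<^sup>2) * deriv F (z\<^sup>2) - ?a * ?b * F (z\<^sup>2) = 0"
      unfolding F_def by (rule hyp2F1_reg_ODE[OF w])
    then have ode: "4 * z * Gamma (3/2) * (z\<^sup>2 * (1 - z\<^sup>2) * deriv (deriv F) (z\<^sup>2) + (3 / 2 - (?a + ?b + 1) * z\<^sup>2) * deriv F (z\<^sup>2) - ?a * ?b * F (z\<^sup>2)) = 0"
      by simp
    have "(1 - z\<^sup>2) * (Gamma (3/2) * (6 * z * deriv F (z\<^sup>2) + 4 * z * z\<^sup>2 * deriv (deriv F) (z\<^sup>2)))
       - (2 * s - 2 * c + 3) * z * ?f' z - s * (s - 2 * c + 2) * odd_solution s c z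
      = 4 * z * Gamma (3/2) * (z\<^sup>2 * (1 - z\<^sup>2) * deriv (deriv F) (z\<^sup>2) + (3 / 2 - (?a + ?b + 1) * z\<^sup>2) * deriv F (z\<^sup>2) - ?a * ?b * F (z\<^sup>2))"
      unfolding odd_solution_def F_def[symmetric] by (simp add: field_simps power2_eq_square)
    with ode show "(1 - z\<^sup>2) * (Gamma (3/2) * (6 * z * deriv F (z\<^sup>2) + 4 * z * z\<^sup>2 * deriv (deriv F) (z\<^sup>2)))
       - (2 * s - 2 * c + 3) * z * ?f' z - s * (s - 2 * c + 2) * odd_solution s c z = 0"
      by simp
  qed
  have "(3/2 :: complex) \<notin> \<int>\<^sub>\<le>\<^sub>0" by (auto elim!: nonpos_Ints_cases simp: complex_eq_iff)
  then show "?f' 0 = 1" by (simp add: F_def rGamma_inverse_Gamma Gamma_eq_zero_iff)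
qed

lemma even_solution_0 [simp]: "even_solution s c 0 = 1"
proof -
  have "(1/2 :: complex) \<notin> \<int>\<^sub>\<le>\<^sub>0" by (auto elim!: nonpos_Ints_cases simp: complex_eq_iff)
  then show ?thesis by (simp add: even_solution_def rGamma_inverse_Gamma Gamma_eq_zero_iff)
qed

lemma odd_solution_0 [simp]: "odd_solution s c 0 = 0"
  by (simp add: odd_solution_def)

text \<open>Abel's identity: (1 - z^2) W' = 2 \<kappa> z W for the Wronskian W, which the derivative
  of the weight (1 - z^2)^\<kappa> compensates. On \<open>D1\<close> the principal power is
  holomorphic.\<close>

lemma gegenbauer_wronskian_constant:
  assumes f: "gegenbauer_solution s c S f f'" and g: "gegenbauer_solution s c S g g'"
    and S: "open S" "connected S" "S \<subseteq> D1"
  shows "\<exists>K. \<forall>z\<in>S. (1 - z\<^sup>2) powr ((2 * s - 2 * c + 3) / 2) * (f z * g' z - f' z * g z) = K"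
proof -
  define \<kappa> where "\<kappa> = (2 * s - 2 * c + 3) / 2"
  have "((\<lambda>z. (1 - z\<^sup>2) powr \<kappa> * (f z * g' z - f' z * g z)) has_field_derivative 0) (at z)" if z: "z \<in> S" for z
  proof -
    have z1: "1 - z\<^sup>2 \<notin> \<real>\<^sub>\<le>\<^sub>0" using one_minus_square_D1 z S(3) by blast
    then have nz: "1 - z\<^sup>2 \<noteq> 0" by auto
    have \<kappa>: "2 * s - 2 * c + 3 = 2 * \<kappa>" by (simp add: \<kappa>_def)
    obtain f'' where f'': "(f' has_field_derivative f'') (at z)"
      "(1 - z\<^sup>2) * f'' - (2 * \<kappa>) * z * f' z - s * (s - 2 * c + 2) * f z = 0"
      using f z unfolding gegenbauer_solution_def \<kappa> by blast
    obtain g'' where g'': "(g' has_field_derivative g'') (at z)"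
      "(1 - z\<^sup>2) * g'' - (2 * \<kappa>) * z * g' z - s * (s - 2 * c + 2) * g z = 0"
      using g z unfolding gegenbauer_solution_def \<kappa> by blast
    have fg: "(f has_field_derivative f' z) (at z)" "(g has_field_derivative g' z) (at z)"
      using f g z by (auto simp: gegenbauer_solution_def)
    have "(1 - z\<^sup>2) * (f z * g'' - f'' * g z) - 2 * \<kappa> * z * (f z * g' z - f' z * g z)
       = f z * ((1 - z\<^sup>2) * g'' - (2 * \<kappa>) * z * g' z - s * (s - 2 * c + 2) * g z)
        - g z * ((1 - z\<^sup>2) * f'' - (2 * \<kappa>) * z * f' z - s * (s - 2 * c + 2) * f z)"
      by (simp add: algebra_simps)
    then have W: "(1 - z\<^sup>2) * (f z * g'' - f'' * g z) = 2 * \<kappa> * z * (f z * g' z - f' z * g z)"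
      unfolding f'' g'' by simp
    have "((\<lambda>z. (1 - z\<^sup>2) powr \<kappa> * (f z * g' z - f' z * g z)) has_field_derivative
      (1 - z\<^sup>2) powr \<kappa> * (f z * g'' - f'' * g z)
       + \<kappa> * (1 - z\<^sup>2) powr (\<kappa> - 1) * (- (2 * z)) * (f z * g' z - f' z * g z)) (at z)"
      using z1 by (auto intro!: derivative_eq_intros fg f''(1) g''(1) simp: algebra_simps)
    moreover have "(1 - z\<^sup>2) powr \<kappa> * (f z * g'' - f'' * g z) = (1 - z\<^sup>2) powr (\<kappa> - 1) * ((1 - z\<^sup>2) * (f z * g'' - f'' * g z))"
      using nz by (simp add: powr_diff)
    ultimately show ?thesis unfolding W by (simp add: algebra_simps)
  qed
  then have "(\<lambda>z. (1 - z\<^sup>2) powr \<kappa> * (f z * g' z - f' z * g z)) constant_on S"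
    using S by (intro has_field_derivative_0_imp_constant_on) auto
  then show ?thesis by (simp add: constant_on_def \<kappa>_def)
qed

text \<open>Cramer's rule: the Wronskians are constant after multiplication by a common weight.\<close>

lemma gegenbauer_solution_basis:
  assumes S: "open S" "connected S" "S \<subseteq> D1"
    and f: "gegenbauer_solution s c S f f'"
    and E: "gegenbauer_solution s c D1 (even_solution s c) E'" "E' 0 = 0"
    and O: "gegenbauer_solution s c D1 (odd_solution s c) O'" "O' 0 = 1"
  shows "\<exists>A B. \<forall>z\<in>S. f z = A * even_solution s c z + B * odd_solution s c z \<and> f' z = A * E' z + B * O' z"
proof -
  define m where "m = (\<lambda>z::complex. (1 - z\<^sup>2) powr ((2 * s - 2 * c + 3) / 2))"
  let ?E = "even_solution s c" and ?O = "odd_solution s c"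
  obtain K where K: "\<And>z. z \<in> D1 \<Longrightarrow> m z * (?E z * O' z - E' z * ?O z) = K"
    using gegenbauer_wronskian_constant[OF E(1) O(1) open_D1 connected_D1] unfolding m_def by auto
  \<comment> \<open>At the origin the weight is 1 and the basis has standard initial values. With K
    = 1 Cramer's rule needs no division.\<close>
  have "K = 1" using K[of 0] E(2) O(2) by (simp add: mem_D1_iff m_def)
  obtain A where A: "\<And>z. z \<in> S \<Longrightarrow> m z * (f z * O' z - f' z * ?O z) = A"
    using gegenbauer_wronskian_constant[OF f gegenbauer_solution_subset[OF O(1) S(3)] S] unfolding m_def by auto
  obtain B where B: "\<And>z. z \<in> S \<Longrightarrow> m z * (f z * E' z - f' z * ?E z) = B"
    using gegenbauer_wronskian_constant[OF f gegenbauer_solution_subset[OF E(1) S(3)] S] unfolding m_def by auto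
  have "f z = A * ?E z + (-B) * ?O z \<and> f' z = A * E' z + (-B) * O' z" if z: "z \<in> S" for z
  proof -
    have 1: "m z * (?E z * O' z - E' z * ?O z) = 1" using K[of z] S(3) z \<open>K = 1\<close> by auto
    have "f z * 1 = A * ?E z + (-B) * ?O z" "f' z * 1 = A * E' z + (-B) * O' z"
      unfolding 1[symmetric] A[OF z, symmetric] B[OF z, symmetric] by (simp_all add: algebra_simps)
    then show ?thesis by simp
  qed
  then show ?thesis by blast
qed

section \<open>The solution at infinity\<close>

definition legendre_series :: "complex \<Rightarrow> complex \<Rightarrow> complex \<Rightarrow> complex" where
  "legendre_series s c z = z powr (-s) * hyp2F1_reg (s / 2) ((s + 1) / 2) c (1 / z\<^sup>2)"

lemma inverse_square_in_hyp_domain: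
  assumes "Im z \<noteq> 0"
  shows "1 / z\<^sup>2 \<in> hyp_domain"
proof (rule ccontr)
  assume "1 / z\<^sup>2 \<notin> hyp_domain"
  then obtain r where r: "r \<ge> 1" "1 / z\<^sup>2 = complex_of_real r" by (auto simp: hyp_domain_def)
  have "z \<noteq> 0" using assms by auto
  with r have "z\<^sup>2 = of_real (1 / r)" by (simp add: field_simps)
  then have "Re z * Im z = 0" "(Re z)\<^sup>2 - (Im z)\<^sup>2 = 1 / r"
    by (auto simp: complex_eq_iff power2_eq_square)
  then have "- (Im z)\<^sup>2 = 1 / r" using assms by auto
  moreover have "1 / r > 0" using r by simp
  ultimately show False by (metis neg_0_less_iff_less not_less zero_le_power2)
qed

lemma powr_pred_complex:
  fixes z :: complex
  assumes "z \<noteq> 0" "a = b + 1"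
  shows "z powr a = z * z powr b"
  using assms by (simp add: powr_add)

text \<open>The derivatives are kept in terms of F, F' and F'' at 1/z^2, the form to which the
  hypergeometric equation applies; a closed form of the first derivative comes separately.\<close>

lemma legendre_series_deriv_aux:
  fixes s c z :: complex
  assumes "Im z > 0"
  defines "F \<equiv> hyp2F1_reg (s / 2) ((s + 1) / 2) c"
  shows "(legendre_series s c has_field_derivative
      - (z powr (-s - 1) * (s * F (1 / z\<^sup>2) + 2 / z\<^sup>2 * deriv F (1 / z\<^sup>2)))) (at z)"
    and "((\<lambda>z. - (z powr (-s - 1) * (s * F (1 / z\<^sup>2) + 2 / z\<^sup>2 * deriv F (1 / z\<^sup>2)))) has_field_derivative
      z powr (-s - 2) * ((s + 1) * (s * F (1 / z\<^sup>2) + 2 / z\<^sup>2 * deriv F (1 / z\<^sup>2))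
        + 2 / z\<^sup>2 * ((s + 2) * deriv F (1 / z\<^sup>2) + 2 / z\<^sup>2 * deriv (deriv F) (1 / z\<^sup>2)))) (at z)"
proof -
  have w: "1 / z\<^sup>2 \<in> hyp_domain" using assms by (intro inverse_square_in_hyp_domain) auto
  have z: "z \<noteq> 0" "z \<notin> \<real>\<^sub>\<le>\<^sub>0" using assms by (auto simp: complex_nonpos_Reals_iff)
  have d: "((\<lambda>z. 1 / z\<^sup>2) has_field_derivative (- 2 / z ^ 3)) (at z)"
    using z by (auto intro!: derivative_eq_intros simp: field_simps eval_nat_numeral)
  note F = has_field_derivative_hyp2F1_reg_compose[where g = "\<lambda>z. 1 / z\<^sup>2", OF w d, of "s / 2" "(s + 1) / 2" c, folded F_def]
  have e: "-2 - s = -s - 2" by simp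
  have P: "((\<lambda>z. z powr p) has_field_derivative p * z powr (p - 1)) (at z)" for p
    using has_field_derivative_powr[OF z(2)] by (simp add: mult_ac)
  have p: "z powr (-s) = z * z powr (-s - 1)" "z powr (-s - 1) = z * z powr (-s - 2)"
    "z powr (-s - 1 - 1) = z powr (-s - 2)"
    using z by (auto intro!: powr_pred_complex simp: algebra_simps)
  show "(legendre_series s c has_field_derivative
      - (z powr (-s - 1) * (s * F (1 / z\<^sup>2) + 2 / z\<^sup>2 * deriv F (1 / z\<^sup>2)))) (at z)"
    unfolding legendre_series_def[abs_def] F_def[symmetric]
    by (rule DERIV_cong[OF DERIV_mult[OF P[of "-s"] F(1)]])
       (use z in \<open>simp add: p(1) power3_eq_cube power2_eq_square divide_simps\<close>, simp add: algebra_simps)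
  have d2: "((\<lambda>z. 2 / z\<^sup>2) has_field_derivative (- 4 / z ^ 3)) (at z)"
    using z by (auto intro!: derivative_eq_intros simp: field_simps eval_nat_numeral)
  show "((\<lambda>z. - (z powr (-s - 1) * (s * F (1 / z\<^sup>2) + 2 / z\<^sup>2 * deriv F (1 / z\<^sup>2)))) has_field_derivative
      z powr (-s - 2) * ((s + 1) * (s * F (1 / z\<^sup>2) + 2 / z\<^sup>2 * deriv F (1 / z\<^sup>2))
        + 2 / z\<^sup>2 * ((s + 2) * deriv F (1 / z\<^sup>2) + 2 / z\<^sup>2 * deriv (deriv F) (1 / z\<^sup>2)))) (at z)"
    by (rule DERIV_cong[OF DERIV_minus[OF DERIV_mult[OF P[of "-s - 1"] DERIV_add[OF DERIV_cmult[OF F(1), of s] DERIV_mult[OF d2 F(2)]]]]])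
       (use z in \<open>simp add: p(2,3) power3_eq_cube power2_eq_square divide_simps\<close>, simp add: algebra_simps e)
qed

text \<open>Raising s/2 by one turns the pair s/2, (s+1)/2 into (s+2)/2, (s+1)/2, which is the pair
  belonging to s + 1 up to order.\<close>

lemma has_field_derivative_legendre_series:
  assumes "Im z > 0"
  shows "(legendre_series s c has_field_derivative - s * legendre_series (s + 1) c z) (at z)"
proof -
  have w: "1 / z\<^sup>2 \<in> hyp_domain" using assms by (intro inverse_square_in_hyp_domain) auto
  let ?F = "hyp2F1_reg (s / 2) ((s + 1) / 2) c"
  have e: "s / 2 + 1 = (s + 1 + 1) / 2" by (simp add: field_simps)
  have "1 / z\<^sup>2 * deriv ?F (1 / z\<^sup>2) + s / 2 * ?F (1 / z\<^sup>2) = s / 2 * hyp2F1_reg ((s + 1) / 2) ((s + 1 + 1) / 2) c (1 / z\<^sup>2)"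
    using hyp2F1_reg_raise_left[OF w, of "s / 2" "(s + 1) / 2" c]
    unfolding e hyp2F1_reg_commute[of "(s + 1 + 1) / 2"] .
  then have "2 * (1 / z\<^sup>2 * deriv ?F (1 / z\<^sup>2) + s / 2 * ?F (1 / z\<^sup>2)) = 2 * (s / 2 * hyp2F1_reg ((s + 1) / 2) ((s + 1 + 1) / 2) c (1 / z\<^sup>2))"
    by (rule arg_cong)
  then have "s * ?F (1 / z\<^sup>2) + 2 / z\<^sup>2 * deriv ?F (1 / z\<^sup>2) = s * hyp2F1_reg ((s + 1) / 2) ((s + 1 + 1) / 2) c (1 / z\<^sup>2)"
    by (simp add: algebra_simps)
  then show ?thesis
    using legendre_series_deriv_aux(1)[OF assms, of s c] by (simp add: legendre_series_def mult_ac)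
qed

lemma gegenbauer_legendre_series:
  "gegenbauer_solution s c {z. Im z > 0} (legendre_series s c) (\<lambda>z. - s * legendre_series (s + 1) c z)"
proof -
  define F where "F = hyp2F1_reg (s / 2) ((s + 1) / 2) c"
  let ?f' = "\<lambda>z. - (z powr (-s - 1) * (s * F (1 / z\<^sup>2) + 2 / z\<^sup>2 * deriv F (1 / z\<^sup>2)))"
  have f': "- s * legendre_series (s + 1) c z = ?f' z" if "Im z > 0" for z
    using has_field_derivative_legendre_series[OF that] legendre_series_deriv_aux(1)[OF that, of s c, folded F_def]
    by (rule DERIV_unique)
  show ?thesis
  proof (rule gegenbauer_solutionI)
    fix z assume "z \<in> {z. Im z > 0}"
    then have z: "Im z > 0" "z \<noteq> 0" by auto
    have w: "1 / z\<^sup>2 \<in> hyp_domain" using z by (intro inverse_square_in_hyp_domain) auto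
    show "(legendre_series s c has_field_derivative - s * legendre_series (s + 1) c z) (at z)"
      by (rule has_field_derivative_legendre_series[OF z(1)])
    have "eventually (\<lambda>z. Im z > 0) (nhds z)"
      using z by (intro eventually_nhds_in_open[of "{z. Im z > 0}", simplified] open_halfspace_Im_gt) auto
    then have ev: "eventually (\<lambda>z. - s * legendre_series (s + 1) c z = ?f' z) (nhds z)"
      by eventually_elim (rule f')
    let ?f'' = "\<lambda>z. z powr (-s - 2) * ((s + 1) * (s * F (1 / z\<^sup>2) + 2 / z\<^sup>2 * deriv F (1 / z\<^sup>2))
        + 2 / z\<^sup>2 * ((s + 2) * deriv F (1 / z\<^sup>2) + 2 / z\<^sup>2 * deriv (deriv F) (1 / z\<^sup>2)))"
    show "((\<lambda>z. - s * legendre_series (s + 1) c z) has_field_derivative ?f'' z) (at z)"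
      by (subst DERIV_cong_ev[OF refl ev refl]) (rule legendre_series_deriv_aux(2)[OF z(1), of s c, folded F_def])
    define w X Y Z where "w = 1 / z\<^sup>2" and "X = F w" and "Y = deriv F w" and "Z = deriv (deriv F) w"
    have "w * (1 - w) * Z + (c - (s / 2 + (s + 1) / 2 + 1) * w) * Y - s / 2 * ((s + 1) / 2) * X = 0"
      unfolding F_def w_def X_def Y_def Z_def by (rule hyp2F1_reg_ODE[OF w])
    \<comment> \<open>With the factor z^(-s) removed and w = 1/z^2, the Gegenbauer operator is -4 w
      times the hypergeometric operator.\<close>
    moreover have "(w - 1) * ((s + 1) * (s * X + 2 * w * Y) + 2 * w * ((s + 2) * Y + 2 * w * Z))
       + (2 * s - 2 * c + 3) * (s * X + 2 * w * Y) - s * (s - 2 * c + 2) * X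
       = -4 * w * (w * (1 - w) * Z + (c - (s / 2 + (s + 1) / 2 + 1) * w) * Y - s / 2 * ((s + 1) / 2) * X)"
      by (simp add: field_simps)
    ultimately have ode: "(w - 1) * ((s + 1) * (s * X + 2 * w * Y) + 2 * w * ((s + 2) * Y + 2 * w * Z))
       + (2 * s - 2 * c + 3) * (s * X + 2 * w * Y) - s * (s - 2 * c + 2) * X = 0"
      by simp
    have p: "z powr (-s) = z\<^sup>2 * z powr (-s - 2)" "z powr (-s - 1) = z * z powr (-s - 2)" 
      using powr_pred_complex[of z "-s" "-s - 1"] powr_pred_complex[of z "-s - 1" "-s - 2"] z
      by (simp_all add: power2_eq_square)
    have "(1 - z\<^sup>2) * ?f'' z - (2 * s - 2 * c + 3) * z * ?f' z - s * (s - 2 * c + 2) * legendre_series s c z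
      = z\<^sup>2 * z powr (-s - 2) * ((w - 1) * ((s + 1) * (s * X + 2 * w * Y) + 2 * w * ((s + 2) * Y + 2 * w * Z))
       + (2 * s - 2 * c + 3) * (s * X + 2 * w * Y) - s * (s - 2 * c + 2) * X)"
    proof -
      have zw: "1 - z\<^sup>2 = z\<^sup>2 * (w - 1)" "2 / z\<^sup>2 = 2 * w" using z by (simp_all add: w_def field_simps)
      show ?thesis
        unfolding legendre_series_def F_def[symmetric] w_def[symmetric] X_def[symmetric] Y_def[symmetric] Z_def[symmetric] zw p
        by (simp add: algebra_simps power2_eq_square)
    qed
    also have "\<dots> = 0" unfolding ode by simp
    finally show "(1 - z\<^sup>2) * ?f'' z - (2 * s - 2 * c + 3) * z * (- s * legendre_series (s + 1) c z)
       - s * (s - 2 * c + 2) * legendre_series s c z = 0"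
      unfolding f'[OF z(1)] .
  qed
qed

section \<open>Boundary values of the Legendre function\<close>

text \<open>The exponential is i^(-s), the phase on the positive imaginary axis. The remaining
  factors are Gauss's sum for the parameters s/2, c - (s+1)/2, c, where sqrt(pi) is
  Gamma(1/2).\<close>

definition legendre_origin_value :: "complex \<Rightarrow> complex \<Rightarrow> complex" where
  "legendre_origin_value s c = of_real (sqrt pi) * exp (- (\<i> * of_real pi * s / 2)) * rGamma (c - s / 2) * rGamma ((s + 1) / 2)"

text \<open>Pfaff's factor (1 - w)^(-s/2) with 1 - w = (1 + y^2)/y^2 contributes y^s, which cancels
  the singular modulus y^(-s) of z^(-s); only (1 + y^2)^(-s/2) and a constant phase remain.\<close>

lemma legendre_series_imaginary_axis:
  assumes y: "y > 0"
  shows "legendre_series s c (\<i> * of_real y) = exp (- (\<i> * of_real pi * s / 2) - s / 2 * of_real (ln (1 + y\<^sup>2)))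
     * hyp2F1_reg (s / 2) (c - (s + 1) / 2) c (of_real (1 / (1 + y\<^sup>2)))"
proof -
  define w where "w = 1 / (\<i> * complex_of_real y)\<^sup>2"
  have w: "w \<in> hyp_domain" unfolding w_def using y by (intro inverse_square_in_hyp_domain) simp
  have pos: "1 + y\<^sup>2 > 0" by (simp add: add_pos_nonneg)
  have w': "w = of_real (- 1 / y\<^sup>2)" by (simp add: w_def power_mult_distrib)
  have "1 - w = of_real (1 + 1 / y\<^sup>2)" by (simp add: w')
  also have "1 + 1 / y\<^sup>2 = (1 + y\<^sup>2) / y\<^sup>2" using y by (simp add: field_simps)
  finally have 1: "1 - w = of_real ((1 + y\<^sup>2) / y\<^sup>2)" .
  have "w / (w - 1) = - w / (1 - w)" by (metis minus_diff_eq minus_divide_divide)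
  also have "\<dots> = of_real ((1 / y\<^sup>2) / ((1 + y\<^sup>2) / y\<^sup>2))" unfolding 1 unfolding w' by simp
  also have "(1 / y\<^sup>2) / ((1 + y\<^sup>2) / y\<^sup>2) = 1 / (1 + y\<^sup>2)" using y by simp
  finally have 2: "w / (w - 1) = of_real (1 / (1 + y\<^sup>2))" .
  have "Ln (\<i> * of_real y) = of_real (ln y) + \<i> * of_real pi / 2"
    using Ln_times_of_real[of y \<i>] y Ln_of_real[of y] by (simp add: mult.commute)
  then have 3: "(\<i> * of_real y) powr (-s) = exp (- s * (of_real (ln y) + \<i> * of_real pi / 2))"
    using y by (simp add: powr_def)
  have "ln ((1 + y\<^sup>2) / y\<^sup>2) = ln (1 + y\<^sup>2) - 2 * ln y"
    using y pos by (simp add: ln_div ln_realpow)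
  then have "Ln (1 - w) = of_real (ln (1 + y\<^sup>2) - 2 * ln y)"
    unfolding 1 using y pos by (subst Ln_of_real) auto
  moreover have "1 - w \<noteq> 0" using w by (auto simp: mem_hyp_domain_iff)
  ultimately have 4: "(1 - w) powr (- (s / 2)) = exp (- (s / 2) * of_real (ln (1 + y\<^sup>2) - 2 * ln y))"
    by (simp add: powr_def)
  have "legendre_series s c (\<i> * of_real y) = (\<i> * of_real y) powr (-s) * ((1 - w) powr (- (s / 2))
     * hyp2F1_reg (s / 2) (c - (s + 1) / 2) c (w / (w - 1)))"
    unfolding legendre_series_def w_def[symmetric] by (subst hyp2F1_reg_pfaff[OF w]) simp
  also have "\<dots> = (exp (- s * (of_real (ln y) + \<i> * of_real pi / 2)) * exp (- (s / 2) * of_real (ln (1 + y\<^sup>2) - 2 * ln y)))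
     * hyp2F1_reg (s / 2) (c - (s + 1) / 2) c (of_real (1 / (1 + y\<^sup>2)))"
    unfolding 2 3 4 by (simp only: mult.assoc)
  also have "exp (- s * (of_real (ln y) + \<i> * of_real pi / 2)) * exp (- (s / 2) * of_real (ln (1 + y\<^sup>2) - 2 * ln y))
    = exp (- (\<i> * of_real pi * s / 2) - s / 2 * of_real (ln (1 + y\<^sup>2)))"
    unfolding exp_add[symmetric] by (simp add: algebra_simps)
  finally show ?thesis .
qed

lemma legendre_series_tendsto_origin:
  "((\<lambda>y. legendre_series s c (\<i> * of_real y)) \<longlongrightarrow> legendre_origin_value s c) (at_right 0)"
proof -
  have f: "filterlim (\<lambda>y::real. 1 / (1 + y\<^sup>2)) (at_left 1) (at_right 0)"
    by real_asymp
  have e: "c - s / 2 - (c - (s + 1) / 2) = 1 / 2" "c - (c - (s + 1) / 2) = (s + 1) / 2"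
    by (simp_all add: field_simps)
  have "((\<lambda>y::real. exp (- (\<i> * of_real pi * s / 2) - s / 2 * of_real (ln (1 + y\<^sup>2)))
     * hyp2F1_reg (s / 2) (c - (s + 1) / 2) c (of_real (1 / (1 + y\<^sup>2))))
     \<longlongrightarrow> exp (- (\<i> * of_real pi * s / 2) - s / 2 * of_real (ln (1 + 0\<^sup>2))) *
       (rGamma (c - s / 2) * rGamma (c - (c - (s + 1) / 2)) * Gamma (c - s / 2 - (c - (s + 1) / 2)))) (at_right 0)"
    by (intro tendsto_intros filterlim_compose[OF hyp2F1_reg_tendsto_at_left_1 f]) (auto simp: e)
  then have "((\<lambda>y::real. exp (- (\<i> * of_real pi * s / 2) - s / 2 * of_real (ln (1 + y\<^sup>2)))
     * hyp2F1_reg (s / 2) (c - (s + 1) / 2) c (of_real (1 / (1 + y\<^sup>2)))) \<longlongrightarrow> legendre_origin_value s c) (at_right 0)"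
    unfolding e by (simp add: legendre_origin_value_def Gamma_one_half_complex mult_ac)
  moreover have "eventually (\<lambda>y::real. exp (- (\<i> * of_real pi * s / 2) - s / 2 * of_real (ln (1 + y\<^sup>2)))
     * hyp2F1_reg (s / 2) (c - (s + 1) / 2) c (of_real (1 / (1 + y\<^sup>2))) = legendre_series s c (\<i> * of_real y)) (at_right 0)"
    using eventually_at_right_less[of 0] by eventually_elim (simp only: legendre_series_imaginary_axis)
  ultimately show ?thesis by (rule Lim_transform_eventually)
qed

lemma gegenbauer_solution_isCont:
  assumes "gegenbauer_solution s c S f f'" "z \<in> S"
  shows "isCont f z" "isCont f' z"
  using assms by (auto simp: gegenbauer_solution_def dest!: bspec[of S _ z] intro: DERIV_isCont)

lemma legendre_series_upper:
  assumes "Im z > 0"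
  shows "legendre_series s c z = legendre_origin_value s c * even_solution s c z
    - s * legendre_origin_value (s + 1) c * odd_solution s c z"
proof -
  let ?U = "{z. Im z > 0}"
  obtain E' where E: "gegenbauer_solution s c D1 (even_solution s c) E'" "E' 0 = 0"
    by (rule gegenbauer_even_solution)
  obtain O' where O: "gegenbauer_solution s c D1 (odd_solution s c) O'" "O' 0 = 1"
    by (rule gegenbauer_odd_solution)
  have U: "open ?U" "connected ?U" "?U \<subseteq> D1"
    by (auto simp: open_halfspace_Im_gt mem_D1_iff intro!: convex_connected convex_halfspace_Im_gt)
  obtain A B where AB: "\<And>z. Im z > 0 \<Longrightarrow> legendre_series s c z = A * even_solution s c z + B * odd_solution s c z"
    "\<And>z. Im z > 0 \<Longrightarrow> - s * legendre_series (s + 1) c z = A * E' z + B * O' z"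
    using gegenbauer_solution_basis[OF U gegenbauer_legendre_series E O] by blast
  have path: "((\<lambda>y. \<i> * complex_of_real y) \<longlongrightarrow> 0) (at_right 0)"
    by (rule tendsto_eq_intros refl | simp)+
  \<comment> \<open>The origin is on the boundary of the half plane, but the even and odd solutions
    are continuous there. Hence A and B are the limits of the two combinations.\<close>
  have "0 \<in> D1" by (simp add: mem_D1_iff)
  note cont = gegenbauer_solution_isCont[OF E(1) this] gegenbauer_solution_isCont[OF O(1) this]
  note lims = cont[THEN isCont_tendsto_compose, OF path]
  have ev: "eventually (\<lambda>y::real. Im (\<i> * complex_of_real y) > 0) (at_right 0)"
    using eventually_at_right_less[of 0] by simp
  have "((\<lambda>y. A * even_solution s c (\<i> * of_real y) + B * odd_solution s c (\<i> * of_real y)) \<longlongrightarrow>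
     A * even_solution s c 0 + B * odd_solution s c 0) (at_right 0)"
    by (intro tendsto_intros lims)
  moreover have "eventually (\<lambda>y. legendre_series s c (\<i> * of_real y) =
      A * even_solution s c (\<i> * of_real y) + B * odd_solution s c (\<i> * of_real y)) (at_right 0)"
    using ev by eventually_elim (rule AB(1))
  ultimately have "((\<lambda>y. legendre_series s c (\<i> * of_real y)) \<longlongrightarrow> A) (at_right 0)"
    by (subst tendsto_cong) simp_all
  then have A: "A = legendre_origin_value s c"
    using legendre_series_tendsto_origin by (rule tendsto_unique[rotated]) simp
  have "((\<lambda>y. A * E' (\<i> * of_real y) + B * O' (\<i> * of_real y)) \<longlongrightarrow> A * E' 0 + B * O' 0) (at_right 0)"
    by (intro tendsto_intros lims)
  moreover have "eventually (\<lambda>y. - s * legendre_series (s + 1) c (\<i> * of_real y) =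
      A * E' (\<i> * of_real y) + B * O' (\<i> * of_real y)) (at_right 0)"
    using ev by eventually_elim (rule AB(2))
  ultimately have "((\<lambda>y. - s * legendre_series (s + 1) c (\<i> * of_real y)) \<longlongrightarrow> B) (at_right 0)"
    by (subst tendsto_cong) (simp_all add: E O)
  moreover have "((\<lambda>y. - s * legendre_series (s + 1) c (\<i> * of_real y)) \<longlongrightarrow> - s * legendre_origin_value (s + 1) c) (at_right 0)"
    by (intro tendsto_intros legendre_series_tendsto_origin)
  ultimately have "B = - s * legendre_origin_value (s + 1) c"
    by (rule tendsto_unique[rotated]) simp
  then show ?thesis using AB(1)[OF assms] A by simp
qed

text \<open>For z in the lower half plane -z is in the upper one. The argument 1/z^2 is unchanged,
  Ln (-z) = Ln z + i pi produces the phase, and parity reverses the sign of the odd part.\<close>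

lemma legendre_series_lower:
  assumes "Im z < 0"
  shows "legendre_series s c z = exp (\<i> * of_real pi * s) *
    (legendre_origin_value s c * even_solution s c z + s * legendre_origin_value (s + 1) c * odd_solution s c z)"
proof -
  have "z \<noteq> 0" using assms by auto
  then have "Ln (- z) = Ln z + \<i> * of_real pi" using assms by (subst Ln_minus) auto
  then have "z powr (-s) = exp (\<i> * of_real pi * s) * (-z) powr (-s)"
    using \<open>z \<noteq> 0\<close> by (simp add: powr_def algebra_simps flip: exp_add)
  then have "legendre_series s c z = exp (\<i> * of_real pi * s) * legendre_series s c (-z)"
    by (simp add: legendre_series_def)
  also have "legendre_series s c (-z) = legendre_origin_value s c * even_solution s c z + s * legendre_origin_value (s + 1) c * odd_solution s c z"
    using assms by (subst legendre_series_upper) (auto simp: even_solution_minus odd_solution_minus)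
  finally show ?thesis .
qed

text \<open>The arguments of 1 + z and 1 - z lie in (0, pi) and (-pi, 0), so their logarithms add
  without a multiple of 2 pi i. The phase stems from Ln (z - 1) = Ln (1 - z) + i pi; in the lower
  half plane both signs are exchanged.\<close>

lemma square_minus_one_powr_upper:
  assumes "Im z > 0"
  shows "(z + 1) powr \<alpha> * (z - 1) powr \<alpha> = exp (\<i> * of_real pi * \<alpha>) * (1 - z\<^sup>2) powr \<alpha>"
proof -
  have nz: "1 + z \<noteq> 0" "1 - z \<noteq> 0" "z + 1 \<noteq> 0" "z - 1 \<noteq> 0" using assms by (auto simp: complex_eq_iff)
  have "Ln (- (1 - z)) = Ln (1 - z) + \<i> * of_real pi" using nz assms by (subst Ln_minus) auto
  then have 1: "Ln (z - 1) = Ln (1 - z) + \<i> * of_real pi" by simp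
  have "0 < Im (Ln (1 + z)) \<and> Im (Ln (1 + z)) < pi" using nz assms by (subst Im_Ln_pos_lt) auto
  moreover have "- pi < Im (Ln (1 - z))" "\<not> 0 \<le> Im (Ln (1 - z))"
    using nz assms Im_Ln_pos_le[of "1 - z"] Im_Ln_le_pi[of "1 - z"] by (auto simp: mpi_less_Im_Ln)
  ultimately have "Ln ((1 + z) * (1 - z)) = Ln (1 + z) + Ln (1 - z)"
    using nz by (intro Ln_times_simple) auto
  moreover have "(1 + z) * (1 - z) = 1 - z\<^sup>2" by (simp add: algebra_simps power2_eq_square)
  ultimately have "Ln (1 - z\<^sup>2) = Ln (z + 1) + Ln (1 - z)" by (simp add: add.commute)
  moreover have "1 - z\<^sup>2 \<noteq> 0" using nz \<open>(1 + z) * (1 - z) = 1 - z\<^sup>2\<close> by (metis mult_eq_0_iff)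
  ultimately show ?thesis
    using nz by (simp add: powr_def 1 algebra_simps flip: exp_add)
qed

lemma square_minus_one_powr_lower:
  assumes "Im z < 0"
  shows "(z + 1) powr \<alpha> * (z - 1) powr \<alpha> = exp (- (\<i> * of_real pi * \<alpha>)) * (1 - z\<^sup>2) powr \<alpha>"
proof -
  have nz: "1 + z \<noteq> 0" "1 - z \<noteq> 0" "z + 1 \<noteq> 0" "z - 1 \<noteq> 0" using assms by (auto simp: complex_eq_iff)
  have "Ln (- (1 - z)) = Ln (1 - z) - \<i> * of_real pi" using nz assms by (subst Ln_minus) auto
  then have 1: "Ln (z - 1) = Ln (1 - z) - \<i> * of_real pi" by simp
  have "0 < Im (Ln (1 - z)) \<and> Im (Ln (1 - z)) < pi" using nz assms by (subst Im_Ln_pos_lt) auto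
  moreover have "- pi < Im (Ln (1 + z))" "\<not> 0 \<le> Im (Ln (1 + z))"
    using nz assms Im_Ln_pos_le[of "1 + z"] Im_Ln_le_pi[of "1 + z"] by (auto simp: mpi_less_Im_Ln)
  ultimately have "Ln ((1 + z) * (1 - z)) = Ln (1 + z) + Ln (1 - z)"
    using nz by (intro Ln_times_simple) auto
  moreover have "(1 + z) * (1 - z) = 1 - z\<^sup>2" by (simp add: algebra_simps power2_eq_square)
  ultimately have "Ln (1 - z\<^sup>2) = Ln (z + 1) + Ln (1 - z)" by (simp add: add.commute)
  moreover have "1 - z\<^sup>2 \<noteq> 0" using nz \<open>(1 + z) * (1 - z) = 1 - z\<^sup>2\<close> by (metis mult_eq_0_iff)
  ultimately show ?thesis
    using nz by (simp add: powr_def 1 algebra_simps flip: exp_add)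
qed

text \<open>What the boundary values from above and below have in common: g stands for the
  continuation across the interval of \<open>legendre_series\<close> from one of the half planes,
  and phases are kept outside.\<close>

definition ferrers_boundary :: "complex \<Rightarrow> complex \<Rightarrow> (complex \<Rightarrow> complex) \<Rightarrow> complex \<Rightarrow> complex" where
  "ferrers_boundary \<nu> \<mu> g z =
    of_real (sqrt pi) * Gamma (\<nu> + \<mu> + 1) / 2 powr (\<nu> + 1) * ((1 - z\<^sup>2) powr (\<mu> / 2) * g z)"

lemma legendre_Q_conv_series:
  assumes "(z + 1) powr (\<mu> / 2) * (z - 1) powr (\<mu> / 2) = e * (1 - z\<^sup>2) powr (\<mu> / 2)"
  shows "legendre_Q \<nu> \<mu> z = exp (\<i> * of_real pi * \<mu>) * e *
      ferrers_boundary \<nu> \<mu> (legendre_series (\<nu> + \<mu> + 1) (\<nu> + 3 / 2)) z"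
proof -
  have h: "hyp2F1_reg ((\<nu> + \<mu> + 2) / 2) ((\<nu> + \<mu> + 1) / 2) (\<nu> + 3 / 2)
      = hyp2F1_reg ((\<nu> + \<mu> + 1) / 2) ((\<nu> + \<mu> + 1 + 1) / 2) (\<nu> + 3 / 2)"
  proof -
    have "\<nu> + \<mu> + 1 + 1 = \<nu> + \<mu> + 2" by simp
    then show ?thesis by (simp only: hyp2F1_reg_commute)
  qed
  show ?thesis
    unfolding legendre_Q_def assms ferrers_boundary_def legendre_series_def h powr_minus
    by (simp only: divide_inverse inverse_mult_distrib mult_ac)
qed

text \<open>On S the Legendre function agrees with a function continuous at x, whose value at x is
  therefore the one-sided limit.\<close>

lemma legendre_Q_limit:
  assumes x: "x \<in> D1" "x islimpt S"
    and Q: "\<And>z. z \<in> S \<Longrightarrow> legendre_Q \<nu> \<mu> z = k * ferrers_boundary \<nu> \<mu> g z"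
    and g: "isCont g x"
  shows "Lim (at x within S) (legendre_Q \<nu> \<mu>) = k * ferrers_boundary \<nu> \<mu> g x"
proof (rule tendsto_Lim)
  show "\<not> trivial_limit (at x within S)" using x(2) by (simp add: trivial_limit_within)
  have "isCont (ferrers_boundary \<nu> \<mu> g) x"
  proof -
    have "isCont (\<lambda>z. (1 - z\<^sup>2) powr (\<mu> / 2)) x"
      using one_minus_square_D1[OF x(1)]
      by (intro isCont_powr_complex isCont_diff isCont_power continuous_const continuous_ident)
    then show ?thesis
      unfolding ferrers_boundary_def[abs_def] by (intro isCont_mult continuous_const g)
  qed
  then have "((\<lambda>z. k * ferrers_boundary \<nu> \<mu> g z) \<longlongrightarrow> k * ferrers_boundary \<nu> \<mu> g x) (at x within S)"
    by (intro tendsto_intros) (auto simp: isCont_def intro: tendsto_within_subset)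
  moreover have "eventually (\<lambda>z. legendre_Q \<nu> \<mu> z = k * ferrers_boundary \<nu> \<mu> g z) (at x within S)"
    using Q by (simp add: eventually_at_topological) (use open_UNIV in blast)
  ultimately show "(legendre_Q \<nu> \<mu> \<longlongrightarrow> k * ferrers_boundary \<nu> \<mu> g x) (at x within S)"
    by (subst tendsto_cong)
qed

lemma islimpt_half_planes:
  "complex_of_real r islimpt {z. Im z > 0}" "complex_of_real r islimpt {z. Im z < 0}"
proof -
  show "complex_of_real r islimpt {z. Im z > 0}"
    unfolding islimpt_approachable
  proof (intro allI impI)
    fix e :: real assume "e > 0"
    then show "\<exists>z\<in>{z. Im z > 0}. z \<noteq> of_real r \<and> dist z (of_real r) < e"
      by (intro bexI[of _ "Complex r (e / 2)"]) (auto simp: dist_norm complex_norm complex_eq_iff cmod_def)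
  qed
  show "complex_of_real r islimpt {z. Im z < 0}"
    unfolding islimpt_approachable
  proof (intro allI impI)
    fix e :: real assume "e > 0"
    then show "\<exists>z\<in>{z. Im z < 0}. z \<noteq> of_real r \<and> dist z (of_real r) < e"
      by (intro bexI[of _ "Complex r (- e / 2)"]) (auto simp: dist_norm complex_norm complex_eq_iff cmod_def)
  qed
qed

text \<open>The phases in the definition of the Ferrers function cancel exactly those of the
  boundary values, leaving the plain average of \<open>g\<^sub>1\<close> and
  \<open>g\<^sub>2\<close>. Adding these gives exp(i pi s) + 1 on the even part and exp(i pi s) - 1
  on the odd part; the factor 1/2 enters the power of 2.\<close>

lemma ferrers_Q_conv_solutions:
  fixes \<nu> \<mu> :: complex
  assumes x: "x \<in> D1"
  defines "s \<equiv> \<nu> + \<mu> + 1" and "c \<equiv> \<nu> + 3 / 2"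
  shows "ferrers_Q \<nu> \<mu> x = of_real (sqrt pi) * Gamma s / 2 powr (\<nu> + 2) * (1 - x\<^sup>2) powr (\<mu> / 2) *
    ((exp (\<i> * of_real pi * s) + 1) * legendre_origin_value s c * even_solution s c x
     + (exp (\<i> * of_real pi * s) - 1) * s * legendre_origin_value (s + 1) c * odd_solution s c x)"
proof -
  define g\<^sub>1 where "g\<^sub>1 = (\<lambda>z. legendre_origin_value s c * even_solution s c z
    - s * legendre_origin_value (s + 1) c * odd_solution s c z)"
  define g\<^sub>2 where "g\<^sub>2 = (\<lambda>z. exp (\<i> * of_real pi * s) *
    (legendre_origin_value s c * even_solution s c z + s * legendre_origin_value (s + 1) c * odd_solution s c z))"
  obtain E' where E: "gegenbauer_solution s c D1 (even_solution s c) E'"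
    by (rule gegenbauer_even_solution)
  obtain O' where O: "gegenbauer_solution s c D1 (odd_solution s c) O'"
    by (rule gegenbauer_odd_solution)
  have hol: "even_solution s c holomorphic_on D1" "odd_solution s c holomorphic_on D1"
    using E O open_D1 by (auto simp: gegenbauer_solution_def holomorphic_on_open)
  have cont: "isCont g\<^sub>1 z" "isCont g\<^sub>2 z" if "z \<in> D1" for z
    unfolding g\<^sub>1_def g\<^sub>2_def
    using gegenbauer_solution_isCont(1)[OF E that] gegenbauer_solution_isCont(1)[OF O that]
    by (auto intro!: continuous_intros)
  define H where "H = (\<lambda>z. 1 / 2 * (ferrers_boundary \<nu> \<mu> g\<^sub>1 z + ferrers_boundary \<nu> \<mu> g\<^sub>2 z))"
  have "ferrers_Q \<nu> \<mu> x = H x"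
    unfolding ferrers_Q_def
  proof (rule analytic_ext_eq[OF _ _ open_D1 connected_D1 _ _ _ x, of _ _ _ 0])
    show "H holomorphic_on D1"
      unfolding H_def ferrers_boundary_def g\<^sub>1_def g\<^sub>2_def using one_minus_square_D1
      by (intro holomorphic_intros hol) auto
    show "complex_of_real ` {-1<..<1} \<subseteq> D1" "0 \<in> D1" by (auto simp: mem_D1_iff)
    show "0 islimpt complex_of_real ` {-1<..<1}"
      unfolding islimpt_approachable
    proof (intro allI impI)
      fix e :: real assume "e > 0"
      then show "\<exists>z\<in>complex_of_real ` {-1<..<1}. z \<noteq> 0 \<and> dist z 0 < e"
        by (intro bexI[of _ "of_real (min (1/2) (e/2))"]) (auto simp: min_def)
    qed
    fix t assume "t \<in> complex_of_real ` {-1<..<1}"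
    then obtain r where r: "t = of_real r" "-1 < r" "r < 1" by auto
    then have t: "t \<in> D1" by (simp add: mem_D1_iff)
    have "legendre_Q \<nu> \<mu> z = exp (\<i> * of_real pi * \<mu>) * exp (\<i> * of_real pi * (\<mu> / 2)) * ferrers_boundary \<nu> \<mu> g\<^sub>1 z"
      if "z \<in> {z. Im z > 0}" for z
    proof -
      from that have z: "Im z > 0" by simp
      show ?thesis
        unfolding legendre_Q_conv_series[OF square_minus_one_powr_upper[OF z]]
        by (simp add: ferrers_boundary_def g\<^sub>1_def legendre_series_upper[OF z] s_def c_def)
    qed
    then have 1: "legendre_Q_above \<nu> \<mu> t = exp (\<i> * of_real pi * \<mu>) * exp (\<i> * of_real pi * (\<mu> / 2)) * ferrers_boundary \<nu> \<mu> g\<^sub>1 t"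
      unfolding legendre_Q_above_def
      by (intro legendre_Q_limit t cont) (simp_all add: r islimpt_half_planes)
    have "legendre_Q \<nu> \<mu> z = exp (\<i> * of_real pi * \<mu>) * exp (- (\<i> * of_real pi * (\<mu> / 2))) * ferrers_boundary \<nu> \<mu> g\<^sub>2 z"
      if "z \<in> {z. Im z < 0}" for z
    proof -
      from that have z: "Im z < 0" by simp
      show ?thesis
        unfolding legendre_Q_conv_series[OF square_minus_one_powr_lower[OF z]]
        by (simp add: ferrers_boundary_def g\<^sub>2_def legendre_series_lower[OF z] s_def c_def)
    qed
    then have 2: "legendre_Q_below \<nu> \<mu> t = exp (\<i> * of_real pi * \<mu>) * exp (- (\<i> * of_real pi * (\<mu> / 2))) * ferrers_boundary \<nu> \<mu> g\<^sub>2 t"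
      unfolding legendre_Q_below_def
      by (intro legendre_Q_limit t cont) (simp_all add: r islimpt_half_planes)
    show "H t = 1 / 2 *
      (exp (- \<i> * of_real pi * \<mu> / 2) * exp (- \<i> * of_real pi * \<mu>) * legendre_Q_above \<nu> \<mu> t
       + exp (\<i> * of_real pi * \<mu> / 2) * exp (- \<i> * of_real pi * \<mu>) * legendre_Q_below \<nu> \<mu> t)"
      unfolding 1 2 H_def by (simp add: exp_minus field_simps)
  qed
  also have "H x = of_real (sqrt pi) * Gamma s / 2 powr (\<nu> + 2) * (1 - x\<^sup>2) powr (\<mu> / 2) *
    ((exp (\<i> * of_real pi * s) + 1) * legendre_origin_value s c * even_solution s c x
     + (exp (\<i> * of_real pi * s) - 1) * s * legendre_origin_value (s + 1) c * odd_solution s c x)"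
  proof -
    have p: "2 powr (\<nu> + 2) = 2 * 2 powr (\<nu> + 1)"
      by (rule powr_pred_complex) auto
    define K P where "K = of_real (sqrt pi) * Gamma s / 2 powr (\<nu> + 1)" and "P = (1 - x\<^sup>2) powr (\<mu> / 2)"
    have fb: "ferrers_boundary \<nu> \<mu> g x = K * (P * g x)" for g
      by (simp add: ferrers_boundary_def K_def P_def s_def)
    have K2: "of_real (sqrt pi) * Gamma s / 2 powr (\<nu> + 2) = K / 2"
      by (simp add: K_def p)
    show ?thesis
      unfolding H_def fb K2 g\<^sub>1_def g\<^sub>2_def P_def[symmetric] by (simp add: field_simps)
  qed
  finally show ?thesis .
qed

section \<open>Reduction to the stated form\<close>

lemma even_solution_pfaff:
  assumes "x \<in> D1"
  shows "hyp2F1 ((2 * c - 1 - s) / 2) (s / 2) (1 / 2) (x\<^sup>2 / (x\<^sup>2 - 1)) = (1 - x\<^sup>2) powr (s / 2) * even_solution s c x"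
proof -
  have w: "x\<^sup>2 \<in> hyp_domain" using assms by (rule square_in_hyp_domain)
  then have nz: "1 - x\<^sup>2 \<noteq> 0" by (auto simp: mem_hyp_domain_iff)
  have c: "(1/2 :: complex) \<notin> \<int>\<^sub>\<le>\<^sub>0" by (auto elim!: nonpos_Ints_cases simp: complex_eq_iff)
  have e: "1 / 2 - (s - 2 * c + 2) / 2 = (2 * c - 1 - s) / 2" by (simp add: field_simps)
  have "even_solution s c x = Gamma (1/2) * ((1 - x\<^sup>2) powr (- (s / 2)) * hyp2F1_reg (s / 2) ((2 * c - 1 - s) / 2) (1 / 2) (x\<^sup>2 / (x\<^sup>2 - 1)))"
    unfolding even_solution_def hyp2F1_reg_pfaff[OF w, of "s / 2"] e ..
  then show ?thesis
    using nz by (simp add: hyp2F1_conv_reg[OF c pfaff_argument[OF w]] hyp2F1_reg_commute[of "s / 2"] powr_minus)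
qed

text \<open>Unlike for the even solution, Pfaff's transformation keeps the second upper parameter,
  here (\<mu> - \<nu> + 1)/2, and replaces (s + 1)/2; this choice leads to the exponent (\<nu> -
  1)/2 of the result.\<close>

lemma odd_solution_pfaff:
  assumes "x \<in> D1"
  shows "x * hyp2F1 ((s - 2 * c + 3) / 2) ((2 - s) / 2) (3 / 2) (x\<^sup>2 / (x\<^sup>2 - 1))
    = (1 - x\<^sup>2) powr ((s - 2 * c + 3) / 2) * odd_solution s c x"
proof -
  have w: "x\<^sup>2 \<in> hyp_domain" using assms by (rule square_in_hyp_domain)
  then have nz: "1 - x\<^sup>2 \<noteq> 0" by (auto simp: mem_hyp_domain_iff)
  have c: "(3/2 :: complex) \<notin> \<int>\<^sub>\<le>\<^sub>0" by (auto elim!: nonpos_Ints_cases simp: complex_eq_iff)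
  have e: "3 / 2 - (s + 1) / 2 = (2 - s) / 2" by (simp add: field_simps)
  let ?a = "(s - 2 * c + 3) / 2"
  have "odd_solution s c x = Gamma (3/2) * (x * ((1 - x\<^sup>2) powr (- ?a) * hyp2F1_reg ?a ((2 - s) / 2) (3 / 2) (x\<^sup>2 / (x\<^sup>2 - 1))))"
    unfolding odd_solution_def hyp2F1_reg_commute[of "(s + 1) / 2"] hyp2F1_reg_pfaff[OF w, of ?a] e ..
  then show ?thesis
    using nz by (simp add: hyp2F1_conv_reg[OF c pfaff_argument[OF w]] powr_minus)
qed

text \<open>Legendre's duplication formula at s/2, divided by one of its two Gamma factors. A pole
  at s/2 or (s + 1)/2 would force s to be an even or odd nonpositive integer.\<close>

lemma Gamma_duplication_halves:
  fixes s :: complex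
  assumes "s \<notin> \<int>\<^sub>\<le>\<^sub>0"
  shows "of_real (sqrt pi) * Gamma s * rGamma ((s + 1) / 2) = 2 powr (s - 1) * Gamma (s / 2)"
    and "of_real (sqrt pi) * Gamma s * rGamma (s / 2) = 2 powr (s - 1) * Gamma ((s + 1) / 2)"
proof -
  have double: "s = 2 * z \<Longrightarrow> z \<notin> \<int>\<^sub>\<le>\<^sub>0" and double': "s + 1 = 2 * z \<Longrightarrow> z \<notin> \<int>\<^sub>\<le>\<^sub>0" for z
  proof -
    show "z \<notin> \<int>\<^sub>\<le>\<^sub>0" if "s = 2 * z"
    proof
      assume "z \<in> \<int>\<^sub>\<le>\<^sub>0"
      then obtain n where "z = - of_nat n" by (auto elim!: nonpos_Ints_cases')
      then have "s = - of_nat (2 * n)" using that by simp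
      then show False using assms by (metis minus_of_nat_in_nonpos_Ints)
    qed
    show "z \<notin> \<int>\<^sub>\<le>\<^sub>0" if "s + 1 = 2 * z"
    proof
      assume "z \<in> \<int>\<^sub>\<le>\<^sub>0"
      then obtain n where "z = - of_nat n" by (auto elim!: nonpos_Ints_cases')
      then have "s = - of_nat (2 * n + 1)" using that by (simp add: eq_diff_eq[symmetric])
      then show False using assms by (metis minus_of_nat_in_nonpos_Ints)
    qed
  qed
  have nz: "s / 2 \<notin> \<int>\<^sub>\<le>\<^sub>0" "(s + 1) / 2 \<notin> \<int>\<^sub>\<le>\<^sub>0"
    using double[of "s / 2"] double'[of "(s + 1) / 2"] by simp_all
  have e: "s / 2 + 1 / 2 = (s + 1) / 2" by (simp add: add_divide_distrib)
  have "Gamma (s / 2) * Gamma ((s + 1) / 2) = exp ((1 - s) * of_real (ln 2)) * of_real (sqrt pi) * Gamma s"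
    using Gamma_legendre_duplication[of "s / 2", unfolded e] nz by simp
  moreover have "exp ((1 - s) * of_real (ln 2)) = inverse (2 powr (s - 1))"
    using Ln_of_real[of 2] by (simp add: powr_def algebra_simps flip: exp_minus)
  ultimately have "Gamma (s / 2) * Gamma ((s + 1) / 2) = inverse (2 powr (s - 1)) * of_real (sqrt pi) * Gamma s"
    by (simp only:)
  then have G: "of_real (sqrt pi) * Gamma s = 2 powr (s - 1) * Gamma (s / 2) * Gamma ((s + 1) / 2)"
    unfolding mult.assoc by (simp only:) simp
  have "Gamma (s / 2) \<noteq> 0" "Gamma ((s + 1) / 2) \<noteq> 0"
    using nz by (simp_all add: Gamma_eq_zero_iff)
  then show "of_real (sqrt pi) * Gamma s * rGamma ((s + 1) / 2) = 2 powr (s - 1) * Gamma (s / 2)"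
    and "of_real (sqrt pi) * Gamma s * rGamma (s / 2) = 2 powr (s - 1) * Gamma ((s + 1) / 2)"
    unfolding G by (simp_all add: rGamma_inverse_Gamma)
qed

theorem theorem4p6:
  fixes x \<mu> \<nu> :: complex
  assumes "x \<in> D1"
    and "\<nu> + \<mu> \<notin> {- of_nat n | n :: nat. n \<ge> 1}"
  shows "ferrers_Q \<nu> \<mu> x =
    of_real (sqrt pi) * 2 powr \<mu> *
    (- Gamma ((\<nu> + \<mu> + 1) / 2) * sin (of_real pi / 2 * (\<nu> + \<mu>)) * rGamma ((\<nu> - \<mu> + 2) / 2)
       / (2 * (1 - x\<^sup>2) powr ((\<nu> + 1) / 2))
       * hyp2F1 ((\<nu> - \<mu> + 1) / 2) ((\<nu> + \<mu> + 1) / 2) (1 / 2) (x\<^sup>2 / (x\<^sup>2 - 1))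
     + Gamma ((\<nu> + \<mu> + 2) / 2) * cos (of_real pi / 2 * (\<nu> + \<mu>)) * x
       * (1 - x\<^sup>2) powr ((\<nu> - 1) / 2) * rGamma ((\<nu> - \<mu> + 1) / 2)
       * hyp2F1 ((\<mu> - \<nu> + 1) / 2) ((- \<nu> - \<mu> + 1) / 2) (3 / 2) (x\<^sup>2 / (x\<^sup>2 - 1)))"
proof -
  define s c where "s = \<nu> + \<mu> + 1" and "c = \<nu> + 3 / 2"
  define E Od P where "E = even_solution s c x" and "Od = odd_solution s c x" and "P = (1 - x\<^sup>2) powr (\<mu> / 2)"
  have nz: "1 - x\<^sup>2 \<noteq> 0" using one_minus_square_D1[OF assms(1)] by auto
  \<comment> \<open>Since s exceeds \<nu> + \<mu> by one, s = -n would mean \<nu> + \<mu> = -(n +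
    1), an excluded value even for n = 0.\<close>
  have s: "s \<notin> \<int>\<^sub>\<le>\<^sub>0"
  proof
    assume "s \<in> \<int>\<^sub>\<le>\<^sub>0"
    then obtain n where "s = - of_nat n" by (auto elim!: nonpos_Ints_cases')
    then have "\<nu> + \<mu> = - of_nat (Suc n)" by (simp add: s_def eq_diff_eq[symmetric])
    then show False using assms(2) by (metis (mono_tags, lifting) le_add1 mem_Collect_eq plus_1_eq_Suc)
  qed
  have even: "hyp2F1 ((\<nu> - \<mu> + 1) / 2) ((\<nu> + \<mu> + 1) / 2) (1 / 2) (x\<^sup>2 / (x\<^sup>2 - 1)) / (1 - x\<^sup>2) powr ((\<nu> + 1) / 2) = P * E"
  proof -
    have "hyp2F1 ((\<nu> - \<mu> + 1) / 2) ((\<nu> + \<mu> + 1) / 2) (1 / 2) (x\<^sup>2 / (x\<^sup>2 - 1)) = (1 - x\<^sup>2) powr (s / 2) * E"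
      using even_solution_pfaff[OF assms(1), of c s] by (simp add: s_def c_def E_def algebra_simps)
    moreover have "(1 - x\<^sup>2) powr (s / 2) = (1 - x\<^sup>2) powr ((\<nu> + 1) / 2) * P"
      using nz by (simp add: P_def s_def add_divide_distrib algebra_simps flip: powr_add)
    ultimately show ?thesis using nz by simp
  qed
  have odd: "x * (1 - x\<^sup>2) powr ((\<nu> - 1) / 2) * hyp2F1 ((\<mu> - \<nu> + 1) / 2) ((- \<nu> - \<mu> + 1) / 2) (3 / 2) (x\<^sup>2 / (x\<^sup>2 - 1)) = P * Od"
  proof -
    have e: "(s - 2 * c + 3) / 2 = (\<mu> - \<nu> + 1) / 2" "(2 - s) / 2 = (- \<nu> - \<mu> + 1) / 2"
      by (simp_all add: s_def c_def)
    have "(1 - x\<^sup>2) powr ((\<nu> - 1) / 2) * (x * hyp2F1 ((\<mu> - \<nu> + 1) / 2) ((- \<nu> - \<mu> + 1) / 2) (3 / 2) (x\<^sup>2 / (x\<^sup>2 - 1)))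
      = (1 - x\<^sup>2) powr ((\<nu> - 1) / 2) * (1 - x\<^sup>2) powr ((\<mu> - \<nu> + 1) / 2) * Od"
      unfolding odd_solution_pfaff[OF assms(1), of s c, unfolded e] Od_def by (simp only: mult.assoc)
    also have "(1 - x\<^sup>2) powr ((\<nu> - 1) / 2) * (1 - x\<^sup>2) powr ((\<mu> - \<nu> + 1) / 2) = P"
    proof -
      have "(\<nu> - 1) / 2 + (\<mu> - \<nu> + 1) / 2 = \<mu> / 2" by (simp add: field_simps)
      then show ?thesis
        using powr_add[of "1 - x\<^sup>2" "(\<nu> - 1) / 2" "(\<mu> - \<nu> + 1) / 2"] nz
        unfolding P_def by (simp only:)
    qed
    finally show ?thesis by (simp only: mult_ac)
  qed
  define \<theta> where "\<theta> = of_real pi / 2 * (\<nu> + \<mu>)"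
  \<comment> \<open>The shift by pi/2 turns the cosine and sine of pi s/2 into -sin \<theta> and cos
    \<theta>.\<close>
  have \<theta>: "\<i> * of_real pi * s / 2 = \<i> * (\<theta> + of_real pi / 2)"
    by (simp add: \<theta>_def s_def algebra_simps add_divide_distrib)
  have exp_s: "exp (\<i> * of_real pi * s) = exp (\<i> * of_real pi * s / 2) * exp (\<i> * of_real pi * s / 2)"
    by (simp add: mult_ac flip: exp_add)
  have sc: "exp (\<i> * (\<theta> + of_real pi / 2)) = \<i> * cos \<theta> - sin \<theta>"
    "exp (- (\<i> * (\<theta> + of_real pi / 2))) = - \<i> * cos \<theta> - sin \<theta>"
    using exp_Euler[of "\<theta> + of_real pi / 2"] exp_minus_Euler[of "\<theta> + of_real pi / 2"]
    by (simp_all add: cos_add sin_add flip: of_real_divide cos_of_real sin_of_real)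
  have unit: "exp (\<i> * of_real pi * s / 2) * exp (- (\<i> * of_real pi * s / 2)) = 1"
    by (simp flip: exp_add)
  \<comment> \<open>The factor exp(-i pi s/2) from the value at the origin makes the coefficients
    exp(i pi s) + 1 and exp(i pi s) - 1 symmetric.\<close>
  have "(exp (\<i> * of_real pi * s) + 1) * exp (- (\<i> * of_real pi * s / 2))
     = exp (\<i> * of_real pi * s / 2) * (exp (\<i> * of_real pi * s / 2) * exp (- (\<i> * of_real pi * s / 2))) + exp (- (\<i> * of_real pi * s / 2))"
    unfolding exp_s by (simp only: ring_distribs mult_1_left mult.assoc)
  also have "\<dots> = - 2 * sin \<theta>" unfolding unit by (simp add: \<theta> sc)
  finally have plus: "(exp (\<i> * of_real pi * s) + 1) * exp (- (\<i> * of_real pi * s / 2)) = - 2 * sin \<theta>" .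
  have "(exp (\<i> * of_real pi * s) - 1) * exp (- (\<i> * of_real pi * s / 2))
     = exp (\<i> * of_real pi * s / 2) * (exp (\<i> * of_real pi * s / 2) * exp (- (\<i> * of_real pi * s / 2))) - exp (- (\<i> * of_real pi * s / 2))"
    unfolding exp_s by (simp only: ring_distribs mult_1_left mult.assoc)
  also have "\<dots> = 2 * \<i> * cos \<theta>" unfolding unit by (simp add: \<theta> sc)
  finally have minus: "(exp (\<i> * of_real pi * s) - 1) * exp (- (\<i> * of_real pi * s / 2)) = 2 * \<i> * cos \<theta>" .
  \<comment> \<open>The odd part carries the value at the origin for s + 1; its extra factor -i
    cancels the i in 2 i cos \<theta>.\<close>
  have exp_s1: "exp (- (\<i> * of_real pi * (s + 1) / 2)) = - \<i> * exp (- (\<i> * of_real pi * s / 2))"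
  proof -
    have "- (\<i> * of_real pi * (s + 1) / 2) = - (\<i> * of_real pi * s / 2) + - (\<i> * (of_real pi / 2))"
      by (simp add: algebra_simps add_divide_distrib)
    moreover have "exp (- (\<i> * (of_real pi / 2))) = - \<i>"
      using exp_minus_Euler[of "of_real pi / 2"] by (simp flip: of_real_divide cos_of_real sin_of_real)
    ultimately show ?thesis by (simp only: exp_add mult.commute)
  qed
  \<comment> \<open>The factor s left by differentiation is absorbed by the functional equation,
    which brings the odd part into a form suited to duplication.\<close>
  have s_rGamma: "s * rGamma ((s + 1 + 1) / 2) = 2 * rGamma (s / 2)"
  proof -
    have "s / 2 * rGamma (s / 2 + 1) = rGamma (s / 2)" by (rule rGamma_plus1)
    moreover have "s / 2 + 1 = (s + 1 + 1) / 2" by (simp add: field_simps)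
    ultimately show ?thesis by simp
  qed
  have args: "c - s / 2 = (\<nu> - \<mu> + 2) / 2" "c - (s + 1) / 2 = (\<nu> - \<mu> + 1) / 2"
    by (simp_all add: s_def c_def field_simps)
  \<comment> \<open>Combined with the coefficients -2 and 4 of the two parts, the 1/4 leaves the
    factors -1/2 and 1 of the result.\<close>
  have pow: "2 powr (s - 1) / 2 powr (\<nu> + 2) = 2 powr \<mu> / (4 :: complex)"
  proof -
    have "2 powr (s - 1) = 2 powr (\<nu> + \<mu>)" by (simp add: s_def)
    also have "\<dots> / 2 powr (\<nu> + 2) = 2 powr \<mu> / (2 powr 2 :: complex)"
      by (simp add: powr_add)
    also have "(2 :: complex) powr 2 = 4" by (simp add: powr_complexnumeral)
    finally show ?thesis .
  qed
  have "ferrers_Q \<nu> \<mu> x = of_real (sqrt pi) * Gamma s / 2 powr (\<nu> + 2) * P *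
    ((exp (\<i> * of_real pi * s) + 1) * legendre_origin_value s c * E
     + (exp (\<i> * of_real pi * s) - 1) * s * legendre_origin_value (s + 1) c * Od)"
    unfolding ferrers_Q_conv_solutions[OF assms(1)] s_def c_def E_def Od_def P_def ..
  also have "\<dots> = of_real (sqrt pi) / 2 powr (\<nu> + 2) * P *
    (((exp (\<i> * of_real pi * s) + 1) * exp (- (\<i> * of_real pi * s / 2)))
        * (of_real (sqrt pi) * Gamma s * rGamma ((s + 1) / 2)) * rGamma ((\<nu> - \<mu> + 2) / 2) * E
     + ((exp (\<i> * of_real pi * s) - 1) * exp (- (\<i> * of_real pi * s / 2))) * (- \<i>)
        * (of_real (sqrt pi) * Gamma s) * (s * rGamma ((s + 1 + 1) / 2)) * rGamma ((\<nu> - \<mu> + 1) / 2) * Od)"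
    unfolding legendre_origin_value_def exp_s1 args by (simp add: algebra_simps)
  also have "\<dots> = of_real (sqrt pi) / 2 powr (\<nu> + 2) * P *
    (- 2 * sin \<theta> * (of_real (sqrt pi) * Gamma s * rGamma ((s + 1) / 2)) * rGamma ((\<nu> - \<mu> + 2) / 2) * E
     + 4 * cos \<theta> * (of_real (sqrt pi) * Gamma s * rGamma (s / 2)) * rGamma ((\<nu> - \<mu> + 1) / 2) * Od)"
    unfolding plus minus s_rGamma by (simp add: algebra_simps)
  also have "\<dots> = of_real (sqrt pi) * (2 powr (s - 1) / 2 powr (\<nu> + 2)) * P *
    (- 2 * sin \<theta> * Gamma (s / 2) * rGamma ((\<nu> - \<mu> + 2) / 2) * E
     + 4 * cos \<theta> * Gamma ((s + 1) / 2) * rGamma ((\<nu> - \<mu> + 1) / 2) * Od)"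
    unfolding Gamma_duplication_halves[OF s] by (simp add: algebra_simps add_divide_distrib)
  also have "\<dots> = of_real (sqrt pi) * 2 powr \<mu> *
    (- Gamma (s / 2) * sin \<theta> * rGamma ((\<nu> - \<mu> + 2) / 2) / 2 * (P * E)
     + Gamma ((s + 1) / 2) * cos \<theta> * rGamma ((\<nu> - \<mu> + 1) / 2) * (P * Od))"
    unfolding pow by (simp add: algebra_simps add_divide_distrib)
  finally show ?thesis
    unfolding even[symmetric] odd[symmetric] \<theta>_def s_def by (simp add: add.assoc mult_ac)
qed

end
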